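(* Let $p$ be a prime and let $\tau$ be a totally bounded linearly invariant Hausdorff topology on a $\mathbb{Z}_p$-vector space $A$ of infinite dimension $\mathbf{m}$. Then there is a set $M$ of cardinality $2^{\mathbf{m}}$ such that, on the set of totally bounded linearly invariant Hausdorff topologies on $A$ (ordered by inclusion), there is a lattice isomorphic to $(2^M;\subset,\cup,\cap)$. Moreover, the initial topology $\tau$ is either the minimal or the maximal element of this lattice. In particular, any totally bounded linearly invariant Hausdorff topology on $A$ can be included in a linear chain of length $2^{\mathbf{m}}$ (i.e. a family of cardinality $2^{\mathbf{m}}$, linearly ordered by inclusion) of different totally bounded linearly invariant Hausdorff topologies on $A$.
   Context: $\mathbb{Z}_p=\mathbb{Z}/p\mathbb{Z}$ is the prime field with $p$ elements. A linearly invariant topology on a $\mathbb{Z}_p$-vector space $A$ is a topology compatible with the vector space structure; since $\mathbb{Z}_p$ is a finite discrete field, this is the same as a group topology on the additive group of $A$. Such a topology is totally bounded if for every neighborhood $U$ of zero there is a finite set $\{0,g_1,\dots,g_k\}\subset A$ such that $U,g_1+U,\dots,g_k+U$ cover $A$. $(2^M;\subset,\cup,\cap)$ denotes the lattice of all subsets of $M$. *)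

theory Defs
  imports "HOL-Analysis.T1_Spaces" "Berlekamp_Zassenhaus.Finite_Field"
begin

unbundle cardinal_syntax

text \<open>Throughout, \<open>'p mod_ring\<close> with \<open>'p :: prime_card\<close> is the field of integers modulo the
  prime \<open>CARD('p)\<close>, and the vector space is a whole type \<open>'a\<close> with scalar multiplication
  \<open>smul\<close>.\<close>

definition linearly_invariant ::
  "('p::prime_card mod_ring \<Rightarrow> 'a::ab_group_add \<Rightarrow> 'a) \<Rightarrow> 'a topology \<Rightarrow> bool" where
  "linearly_invariant smul \<tau> \<longleftrightarrow>
     topspace \<tau> = UNIV \<and>
     continuous_map (prod_topology \<tau> \<tau>) \<tau> (\<lambda>(x, y). x + y) \<and>
     continuous_map (prod_topology (discrete_topology UNIV) \<tau>) \<tau> (\<lambda>(c, x). smul c x)"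

text \<open>Neighbourhoods of zero need not be open.\<close>

definition totally_bounded_top :: "'a::ab_group_add topology \<Rightarrow> bool" where
  "totally_bounded_top \<tau> \<longleftrightarrow>
     (\<forall>U. (\<exists>V. openin \<tau> V \<and> 0 \<in> V \<and> V \<subseteq> U) \<longrightarrow>
          (\<exists>G. finite G \<and> (\<Union>g\<in>insert 0 G. (\<lambda>x. g + x) ` U) = UNIV))"

definition tbh_topologies ::
  "('p::prime_card mod_ring \<Rightarrow> 'a::ab_group_add \<Rightarrow> 'a) \<Rightarrow> 'a topology set" where
  "tbh_topologies smul =
     {\<tau>. linearly_invariant smul \<tau> \<and> totally_bounded_top \<tau> \<and> Hausdorff_space \<tau>}"

definition top_le :: "'a topology \<Rightarrow> 'a topology \<Rightarrow> bool"  (infix \<open>\<preceq>\<close> 50) where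
  "\<sigma> \<preceq> \<tau> \<longleftrightarrow> {U. openin \<sigma> U} \<subseteq> {U. openin \<tau> U}"

definition is_sup_in :: "'a topology set \<Rightarrow> 'a topology \<Rightarrow> 'a topology \<Rightarrow> 'a topology \<Rightarrow> bool" where
  "is_sup_in P \<sigma> \<tau> \<rho> \<longleftrightarrow>
     \<rho> \<in> P \<and> \<sigma> \<preceq> \<rho> \<and> \<tau> \<preceq> \<rho> \<and> (\<forall>\<upsilon>\<in>P. \<sigma> \<preceq> \<upsilon> \<and> \<tau> \<preceq> \<upsilon> \<longrightarrow> \<rho> \<preceq> \<upsilon>)"

definition is_inf_in :: "'a topology set \<Rightarrow> 'a topology \<Rightarrow> 'a topology \<Rightarrow> 'a topology \<Rightarrow> bool" where
  "is_inf_in P \<sigma> \<tau> \<rho> \<longleftrightarrow>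
     \<rho> \<in> P \<and> \<rho> \<preceq> \<sigma> \<and> \<rho> \<preceq> \<tau> \<and> (\<forall>\<upsilon>\<in>P. \<upsilon> \<preceq> \<sigma> \<and> \<upsilon> \<preceq> \<tau> \<longrightarrow> \<upsilon> \<preceq> \<rho>)"

text \<open>\<open>F\<close> is an isomorphism from the lattice of all subsets of \<open>M\<close> onto a sublattice \<open>L\<close> of the
  set of topologies \<open>P\<close>, ordered by inclusion: suprema and infima are taken in all of \<open>P\<close>, not
  merely in \<open>L\<close>. (The set-theoretic intersection of two topologies in \<open>P\<close> need not be
  in \<open>P\<close>.)\<close>

definition powerset_lattice_iso ::
  "'b set \<Rightarrow> 'a topology set \<Rightarrow> 'a topology set \<Rightarrow> ('b set \<Rightarrow> 'a topology) \<Rightarrow> bool" where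
  "powerset_lattice_iso M P L F \<longleftrightarrow>
     L \<subseteq> P \<and> bij_betw F (Pow M) L \<and>
     (\<forall>S\<in>Pow M. \<forall>T\<in>Pow M.
        (S \<subseteq> T \<longleftrightarrow> F S \<preceq> F T) \<and>
        is_sup_in P (F S) (F T) (F (S \<union> T)) \<and>
        is_inf_in P (F S) (F T) (F (S \<inter> T)))"

end

theory Submission
  imports Defs "HOL-Library.Function_Algebras"
begin

text \<open>Totally bounded linearly invariant Hausdorff topologies correspond, as an ordered set, to the
  subspaces of the algebraic dual of \<open>A\<close> that separate points: \<open>W\<close> corresponds to the coarsest
  topology in which all functionals in \<open>W\<close> are continuous.  That every such topology \<open>\<tau>\<close> comes from its
  continuous functionals rests on Bogolyubov's theorem: if finitely many translates of \<open>V\<close> cover \<open>A\<close>,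
  then \<open>V + V - V - V\<close> contains a subspace of finite index.  This is proved by Fourier analysis on
  the finite-dimensional subspaces, with a codimension bound that depends only on the number of
  translates, and transferred to \<open>A\<close> by Tychonoff's theorem.

  The dual has dimension \<open>2\<^bsup>m\<^esup>\<close>, and every separating subspace contains a separating subspace of
  dimension at most \<open>m\<close>.  Hence the subspace of \<open>\<tau>\<close> can be enlarged by, or arises from a smaller
  separating one through adjoining, \<open>2\<^bsup>m\<^esup>\<close> independent functionals.  The spans obtained by adjoining
  arbitrary subsets of these functionals form the lattice, and the initial segments of a
  well-order on them yield the chain.\<close>

section \<open>Bogolyubov's theorem\<close>

definition additive_char :: "'p::nontriv mod_ring \<Rightarrow> complex" where
  "additive_char a = cis (2 * pi * real_of_int (to_int_mod_ring a) / real CARD('p))"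

lemma cis_mod_period:
  assumes "p > 0"
  shows "cis (2 * pi * real_of_int (x mod int p) / real p) = cis (2 * pi * real_of_int x / real p)"
proof -
  have "real_of_int x = real p * real_of_int (x div int p) + real_of_int (x mod int p)"
    by (metis mult_div_mod_eq of_int_add of_int_mult of_int_of_nat_eq)
  hence "2 * pi * real_of_int x / real p
      = 2 * pi * real_of_int (x div int p) + 2 * pi * real_of_int (x mod int p) / real p"
    using assms by (simp add: field_simps)
  thus ?thesis by (simp add: cis_mult[symmetric] cis_multiple_2pi)
qed

lemma additive_char_add:
  "additive_char (a + b) = additive_char a * additive_char (b :: 'p::nontriv mod_ring)"
proof -
  have "to_int_mod_ring (a + b) = (to_int_mod_ring a + to_int_mod_ring b) mod int CARD('p)"
    by transfer simp
  hence "additive_char (a + b)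
      = cis (2 * pi * real_of_int (to_int_mod_ring a + to_int_mod_ring b) / real CARD('p))"
    unfolding additive_char_def by (simp only: cis_mod_period zero_less_card_finite)
  thus ?thesis unfolding additive_char_def
    by (simp add: cis_mult field_simps)
qed

lemma norm_additive_char [simp]: "norm (additive_char a) = 1"
  by (simp add: additive_char_def)

lemma additive_char_0 [simp]: "additive_char 0 = 1"
  by (simp add: additive_char_def)

lemma additive_char_diff: "additive_char (a - b) = additive_char a * cnj (additive_char b)"
proof -
  have "additive_char (a - b) * additive_char b = additive_char a"
    by (simp flip: additive_char_add)
  moreover have "additive_char b * cnj (additive_char b) = 1"
    by (simp add: complex_norm_square[symmetric])
  ultimately show ?thesis
    by (metis mult.assoc mult.right_neutral)
qed

lemma additive_char_eq_1_iff: "additive_char (a :: 'p::nontriv mod_ring) = 1 \<longleftrightarrow> a = 0"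
proof
  assume *: "additive_char a = 1"
  define t where "t = to_int_mod_ring a"
  have t: "0 \<le> t" "t < int CARD('p)"
    using range_to_int_mod_ring[where 'a='p] unfolding t_def by fastforce+
  have "cos (2 * pi * real_of_int t / real CARD('p)) = 1"
    using * unfolding additive_char_def t_def by (metis cis.simps(1) one_complex.simps(1))
  then obtain n :: int where "2 * pi * real_of_int t / real CARD('p) = real_of_int n * 2 * pi"
    unfolding cos_one_2pi_int by blast
  hence "real_of_int t = real_of_int n * real CARD('p)" by (simp add: field_simps)
  hence "t = n * int CARD('p)"
    by (metis of_int_eq_iff of_int_mult of_int_of_nat_eq)
  hence "t = 0" using t
    by (metis dvd_triv_right mod_0_imp_dvd mod_pos_pos_trivial dvd_imp_mod_0)
  thus "a = 0" by (simp add: t_def)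
qed simp

text \<open>Orthogonality of characters: shifting the summation index by \<open>g0\<close> with
  \<open>h g0 \<noteq> 0\<close> multiplies the sum by a factor other than 1. The form covers both
  uses, namely sums over vectors with a fixed functional and sums over functionals evaluated at a
  fixed vector.\<close>

lemma additive_char_sum:
  fixes H :: "'g::ab_group_add set" and h :: "'g \<Rightarrow> 'p::nontriv mod_ring"
  assumes H: "\<And>x y. x \<in> H \<Longrightarrow> y \<in> H \<Longrightarrow> x - y \<in> H"
    and h: "\<And>x y. x \<in> H \<Longrightarrow> y \<in> H \<Longrightarrow> h (x - y) = h x - h y"
  shows "(\<Sum>g\<in>H. additive_char (h g)) = (if \<forall>g\<in>H. h g = 0 then of_nat (card H) else 0)"
proof (cases "\<forall>g\<in>H. h g = 0")
  case False
  then obtain g0 where g0: "g0 \<in> H" "h g0 \<noteq> 0" by blast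
  have plus: "x + g0 \<in> H" if "x \<in> H" for x
    using H[OF that H[OF H[OF g0(1) g0(1)] g0(1)]] by simp
  have "(\<Sum>g\<in>H. additive_char (h g)) = (\<Sum>g\<in>H. additive_char (h (g - g0)))"
    by (rule sum.reindex_bij_witness[where i = "\<lambda>x. x - g0" and j = "\<lambda>x. x + g0"])
       (auto simp: plus H g0)
  also have "\<dots> = (\<Sum>g\<in>H. additive_char (h g)) * cnj (additive_char (h g0))"
    by (simp add: h g0 additive_char_diff sum_distrib_right)
  finally have "(\<Sum>g\<in>H. additive_char (h g)) = 0 \<or> cnj (additive_char (h g0)) = 1"
    by simp
  moreover have "cnj (additive_char (h g0)) \<noteq> 1"
    using g0 by (metis additive_char_eq_1_iff complex_cnj_cnj complex_cnj_one)
  ultimately show ?thesis using False by auto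
qed simp

text \<open>This is \<open>V + V - V - V\<close>. With four summands the Fourier coefficients of
  \<open>V\<close> enter through the fourth power of their modulus, and replacing \<open>V\<close>
  by a translate changes nothing.\<close>

definition twofold_difference :: "'a::ab_group_add set \<Rightarrow> 'a set" where
  "twofold_difference V = {a + b - (c + d) |a b c d. a \<in> V \<and> b \<in> V \<and> c \<in> V \<and> d \<in> V}"

text \<open>Bogolyubov's argument: the functionals in \<open>S\<close> are those at which the Fourier transform of the
  indicator function of \<open>D\<close> is large.  If \<open>x\<close> is killed by all of \<open>S\<close>, the contribution of
  \<open>S\<close> to the Fourier expansion of the number of representations of \<open>x\<close> dominates the rest.\<close>

lemma bogolyubov_finite:
  fixes D E :: "'a::ab_group_add set" and X :: "('a \<Rightarrow> 'p::nontriv mod_ring) set"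
  assumes fin: "finite E" "finite X"
    and E: "0 \<in> E" "\<And>x y. x \<in> E \<Longrightarrow> y \<in> E \<Longrightarrow> x - y \<in> E"
    and X: "0 \<in> X" "\<And>\<phi> \<psi>. \<phi> \<in> X \<Longrightarrow> \<psi> \<in> X \<Longrightarrow> \<phi> - \<psi> \<in> X"
    and hom: "\<And>\<phi> x y. \<phi> \<in> X \<Longrightarrow> \<phi> (x - y) = \<phi> x - \<phi> y"
    and sepE: "\<And>x. x \<in> E \<Longrightarrow> x \<noteq> 0 \<Longrightarrow> \<exists>\<phi>\<in>X. \<phi> x \<noteq> 0"
    and sepX: "\<And>\<phi>. \<phi> \<in> X \<Longrightarrow> \<phi> \<noteq> 0 \<Longrightarrow> \<exists>x\<in>E. \<phi> x \<noteq> 0"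
    and D: "D \<subseteq> E" "card E \<le> k * card D"
  shows "\<exists>S\<subseteq>X. card S \<le> k\<^sup>2 \<and>
    (\<forall>x\<in>E. (\<forall>\<phi>\<in>S. \<phi> x = 0) \<longrightarrow> x \<in> twofold_difference D)"
proof -
  \<comment> \<open>The unnormalised Fourier coefficient at \<open>\<phi>\<close> of the indicator
    function of \<open>D'\<close>.\<close>
  define ft where "ft D' \<phi> = (\<Sum>a\<in>D'. additive_char (\<phi> a))" for D' and \<phi> :: "'a \<Rightarrow> 'p mod_ring"
  have hom0: "\<phi> 0 = 0" if "\<phi> \<in> X" for \<phi> using hom[OF that, of 0 0] by simp
  have hom_add: "\<phi> (x + y) = \<phi> x + \<phi> y" if "\<phi> \<in> X" for \<phi> x y
    using hom[OF that, of "x + y" y] by simp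
  have E_add: "x + y \<in> E" if "x \<in> E" "y \<in> E" for x y
    using E(2)[OF that(1) E(2)[OF E(1) that(2)]] by simp
  have orth: "(\<Sum>\<phi>\<in>X. additive_char (\<phi> x)) = (if x = 0 then of_nat (card X) else 0)" if "x \<in> E" for x
  proof -
    have "(\<Sum>\<phi>\<in>X. additive_char (\<phi> x)) = (if \<forall>\<phi>\<in>X. \<phi> x = 0 then of_nat (card X) else 0)"
      by (rule additive_char_sum) (auto simp: X)
    thus ?thesis using sepE[OF that] hom0 by auto
  qed
  have parseval: "(\<Sum>\<phi>\<in>X. ft D' \<phi> * cnj (ft D' \<phi>)) = of_nat (card X * card D')" if "D' \<subseteq> E" for D'
  proof -
    have finD: "finite D'" using that fin finite_subset by blast
    have "(\<Sum>\<phi>\<in>X. ft D' \<phi> * cnj (ft D' \<phi>))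
        = (\<Sum>\<phi>\<in>X. \<Sum>a\<in>D'. \<Sum>c\<in>D'. additive_char (\<phi> (a - c)))"
      by (rule sum.cong) (auto simp: ft_def cnj_sum sum_product hom additive_char_diff)
    also have "\<dots> = (\<Sum>a\<in>D'. \<Sum>\<phi>\<in>X. \<Sum>c\<in>D'. additive_char (\<phi> (a - c)))"
      by (rule sum.swap)
    also have "\<dots> = (\<Sum>a\<in>D'. \<Sum>c\<in>D'. \<Sum>\<phi>\<in>X. additive_char (\<phi> (a - c)))"
      by (rule sum.cong[OF refl], rule sum.swap)
    also have "\<dots> = (\<Sum>a\<in>D'. \<Sum>c\<in>D'. if a = c then of_nat (card X) else 0)"
      using that by (intro sum.cong refl) (subst orth, auto intro: E)
    also have "\<dots> = of_nat (card X * card D')" using finD by simp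
    finally show ?thesis .
  qed
  have cE: "card E > 0" using fin E by (auto simp: card_gt_0_iff)
  \<comment> \<open>Parseval applied to \<open>E\<close> itself: only the coefficient at 0 survives,
    and it equals \<open>card E\<close>.\<close>
  have cX: "card X = card E"
  proof -
    have "ft E \<phi> = (if \<phi> = 0 then of_nat (card E) else 0)" if "\<phi> \<in> X" for \<phi>
    proof -
      have "ft E \<phi> = (if \<forall>x\<in>E. \<phi> x = 0 then of_nat (card E) else 0)"
        unfolding ft_def by (rule additive_char_sum) (auto simp: E hom that)
      thus ?thesis using sepX[OF that] by auto
    qed
    hence "(\<Sum>\<phi>\<in>X. ft E \<phi> * cnj (ft E \<phi>))
        = (\<Sum>\<phi>\<in>X. if \<phi> = 0 then of_nat (card E * card E) else 0)"
      by (intro sum.cong refl) simp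
    also have "\<dots> = of_nat (card E * card E)" using X fin by simp
    finally have "card X * card E = card E * card E"
      using parseval[of E] by (metis of_nat_eq_iff order_refl)
    thus ?thesis using cE by simp
  qed
  define q where "q = real (card E)"
  define d where "d = real (card D)"
  define F where "F \<phi> = (norm (ft D \<phi>))\<^sup>2" for \<phi>
  \<comment> \<open>The threshold balances two estimates. At most q d / \<theta> = (q/d)^2 \<le> k^2
    functionals reach it, while those below it contribute at most \<theta> (q d - d^2) = d^4 -
    d^5/q, which is less than the term d^4 coming from the zero functional.\<close>
  define \<theta> where "\<theta> = d ^ 3 / q"
  define S where "S = {\<phi> \<in> X. \<theta> \<le> F \<phi>}"
  have q: "q > 0" using cE by (simp add: q_def)
  have d: "d > 0" using cE D(2) by (cases "card D") (auto simp: d_def)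
  have finD: "finite D" using D fin finite_subset by blast
  have "d \<le> q" unfolding d_def q_def using D fin by (simp add: card_mono)
  have qk: "q \<le> real k * d" unfolding q_def d_def using D(2) by (metis of_nat_le_iff of_nat_mult)
  have F_complex: "complex_of_real (F \<phi>) = ft D \<phi> * cnj (ft D \<phi>)" for \<phi>
    unfolding F_def by (simp only: complex_norm_square)
  have F_nonneg: "0 \<le> F \<phi>" for \<phi> by (simp add: F_def)
  have sumF: "(\<Sum>\<phi>\<in>X. F \<phi>) = q * d"
  proof -
    have "complex_of_real (\<Sum>\<phi>\<in>X. F \<phi>) = complex_of_real (q * d)"
      using parseval[OF D(1)] by (simp add: F_complex cX q_def d_def)
    thus ?thesis using of_real_eq_iff by blast
  qed
  have F0: "F 0 = d\<^sup>2" by (simp add: F_def ft_def d_def)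
  have \<theta>: "\<theta> > 0" using q d by (simp add: \<theta>_def)
  have "d ^ 3 \<le> d\<^sup>2 * q" using \<open>d \<le> q\<close> d by (simp add: power3_eq_cube power2_eq_square)
  hence S0: "0 \<in> S" unfolding S_def using X F0 q by (simp add: \<theta>_def field_simps)
  have finS: "finite S" and SX: "S \<subseteq> X" using fin by (auto simp: S_def)
  have cardS: "card S \<le> k\<^sup>2"
  proof -
    have "real (card S) * \<theta> = (\<Sum>\<phi>\<in>S. \<theta>)" by simp
    also have "\<dots> \<le> (\<Sum>\<phi>\<in>S. F \<phi>)" by (rule sum_mono) (simp add: S_def)
    also have "\<dots> \<le> q * d" unfolding sumF[symmetric]
      by (rule sum_mono2) (use fin SX F_nonneg in auto)
    finally have "real (card S) * d ^ 3 \<le> q\<^sup>2 * d"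
      using q by (simp add: \<theta>_def field_simps power2_eq_square)
    hence "(real (card S) * d\<^sup>2) * d \<le> q\<^sup>2 * d" by (simp add: power3_eq_cube power2_eq_square mult.assoc)
    hence "real (card S) * d\<^sup>2 \<le> q\<^sup>2" using d by simp
    also have "\<dots> \<le> (real k * d)\<^sup>2" using qk q by (intro power_mono) auto
    finally have "real (card S) * d\<^sup>2 \<le> (real k)\<^sup>2 * d\<^sup>2" by (simp add: power_mult_distrib)
    hence "real (card S) \<le> (real k)\<^sup>2" using d by simp
    thus ?thesis by (metis of_nat_le_iff of_nat_power)
  qed
  have rep: "x \<in> twofold_difference D"
    if x: "x \<in> E" "\<forall>\<phi>\<in>S. \<phi> x = 0" for x
  proof (rule ccontr)
    assume no: "\<not> ?thesis"
    define P where "P = D \<times> D"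
    have finP: "finite P" using finD by (simp add: P_def)
    define s where "s = (\<lambda>(a::'a, b). a + b)"
    have sE: "s u \<in> E" if "u \<in> P" for u using that D(1) E_add by (auto simp: s_def P_def)
    have sq: "ft D \<phi> * ft D \<phi> = (\<Sum>u\<in>P. additive_char (\<phi> (s u)))" if "\<phi> \<in> X" for \<phi>
      unfolding ft_def sum_product P_def
      by (simp add: sum.cartesian_product s_def case_prod_unfold hom_add that additive_char_add)
    have expand: "(of_real (F \<phi>))\<^sup>2 * cnj (additive_char (\<phi> x))
        = (\<Sum>u\<in>P. \<Sum>v\<in>P. additive_char (\<phi> (s u - s v - x)))" if "\<phi> \<in> X" for \<phi>
    proof -
      have "(of_real (F \<phi>))\<^sup>2 = (ft D \<phi> * ft D \<phi>) * cnj (ft D \<phi> * ft D \<phi>)"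
        unfolding F_complex by (simp add: power2_eq_square)
      also have "\<dots> = (\<Sum>u\<in>P. \<Sum>v\<in>P. additive_char (\<phi> (s u - s v)))"
        by (simp add: sq that cnj_sum sum_product hom additive_char_diff)
      finally show ?thesis
        by (simp add: sum_distrib_right hom that additive_char_diff)
    qed
    \<comment> \<open>By orthogonality this sum is \<open>card X\<close> times the number of pairs
      \<open>u\<close>, \<open>v\<close> with \<open>s u - s v = x\<close>; under the assumption
      \<open>no\<close> there are none.\<close>
    have "(\<Sum>\<phi>\<in>X. (of_real (F \<phi>))\<^sup>2 * cnj (additive_char (\<phi> x)))
        = (\<Sum>\<phi>\<in>X. \<Sum>u\<in>P. \<Sum>v\<in>P. additive_char (\<phi> (s u - s v - x)))"
      by (rule sum.cong) (auto simp: expand)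
    also have "\<dots> = (\<Sum>u\<in>P. \<Sum>\<phi>\<in>X. \<Sum>v\<in>P. additive_char (\<phi> (s u - s v - x)))"
      by (rule sum.swap)
    also have "\<dots> = (\<Sum>u\<in>P. \<Sum>v\<in>P. \<Sum>\<phi>\<in>X. additive_char (\<phi> (s u - s v - x)))"
      by (rule sum.cong[OF refl], rule sum.swap)
    also have "\<dots> = 0"
    proof (rule sum.neutral, rule ballI, rule sum.neutral, rule ballI)
      fix u v assume uv: "u \<in> P" "v \<in> P"
      have "s u - s v - x \<noteq> 0"
      proof
        assume "s u - s v - x = 0"
        hence "x = fst u + snd u - (fst v + snd v)" by (simp add: s_def case_prod_unfold)
        thus False using no uv unfolding P_def twofold_difference_def by (auto simp: mem_Times_iff)
      qed
      thus "(\<Sum>\<phi>\<in>X. additive_char (\<phi> (s u - s v - x))) = 0"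
        using uv x by (subst orth) (auto intro!: E sE)
    qed
    finally have "Re (\<Sum>\<phi>\<in>X. (of_real (F \<phi>))\<^sup>2 * cnj (additive_char (\<phi> x))) = 0" by simp
    hence zero: "0 = (\<Sum>\<phi>\<in>X. Re ((of_real (F \<phi>))\<^sup>2 * cnj (additive_char (\<phi> x))))"
      by (simp only: Re_sum)
    have Re: "Re ((of_real (F \<phi>))\<^sup>2 * cnj (additive_char (\<phi> x)))
        = (F \<phi>)\<^sup>2 * Re (additive_char (\<phi> x))" for \<phi>
      by (simp add: power2_eq_square)
    have split: "0 = (\<Sum>\<phi>\<in>X - S. (F \<phi>)\<^sup>2 * Re (additive_char (\<phi> x)))
        + (\<Sum>\<phi>\<in>S. (F \<phi>)\<^sup>2 * Re (additive_char (\<phi> x)))"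
      using zero unfolding Re by (subst (asm) sum.subset_diff[OF SX fin(2)])
    have large: "(\<Sum>\<phi>\<in>S. (F \<phi>)\<^sup>2 * Re (additive_char (\<phi> x))) = (\<Sum>\<phi>\<in>S. (F \<phi>)\<^sup>2)"
      using x(2) by (intro sum.cong) auto
    have "(\<Sum>\<phi>\<in>X - S. - (\<theta> * F \<phi>)) \<le> (\<Sum>\<phi>\<in>X - S. (F \<phi>)\<^sup>2 * Re (additive_char (\<phi> x)))"
    proof (rule sum_mono)
      fix \<phi> assume "\<phi> \<in> X - S"
      hence le: "F \<phi> \<le> \<theta>" by (auto simp: S_def)
      have "- 1 \<le> Re (additive_char (\<phi> x))"
        using abs_Re_le_cmod[of "additive_char (\<phi> x)"] by simp
      hence "(F \<phi>)\<^sup>2 * (- 1) \<le> (F \<phi>)\<^sup>2 * Re (additive_char (\<phi> x))"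
        by (intro mult_left_mono) auto
      moreover have "(F \<phi>)\<^sup>2 \<le> \<theta> * F \<phi>"
        unfolding power2_eq_square using le F_nonneg by (intro mult_right_mono)
      ultimately show "- (\<theta> * F \<phi>) \<le> (F \<phi>)\<^sup>2 * Re (additive_char (\<phi> x))" by linarith
    qed
    hence upper: "(\<Sum>\<phi>\<in>S. (F \<phi>)\<^sup>2) \<le> \<theta> * (\<Sum>\<phi>\<in>X - S. F \<phi>)"
      using split large by (simp add: sum_negf sum_distrib_left)
    have lower: "(F 0)\<^sup>2 \<le> (\<Sum>\<phi>\<in>S. (F \<phi>)\<^sup>2)"
      by (rule member_le_sum[OF S0 _ finS]) simp
    \<comment> \<open>Since 0 lies in \<open>S\<close>, its mass \<open>F 0\<close> is missing from
      the sum over \<open>X - S\<close>. This saving makes the small coefficients lose strictly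
      against d^4.\<close>
    have "(\<Sum>\<phi>\<in>X - S. F \<phi>) = q * d - (\<Sum>\<phi>\<in>S. F \<phi>)"
      using sum.subset_diff[OF SX fin(2), of F] sumF by simp
    moreover have "F 0 \<le> (\<Sum>\<phi>\<in>S. F \<phi>)"
      by (rule member_le_sum[OF S0 _ finS]) (rule F_nonneg)
    ultimately have "\<theta> * (\<Sum>\<phi>\<in>X - S. F \<phi>) \<le> \<theta> * (q * d - d\<^sup>2)"
      using \<theta> F0 by (intro mult_left_mono) auto
    hence "(d\<^sup>2)\<^sup>2 \<le> \<theta> * (q * d - d\<^sup>2)"
      using lower upper F0 by simp
    also have "\<dots> = d ^ 4 - d ^ 5 / q"
      using q by (simp add: \<theta>_def field_simps power2_eq_square eval_nat_numeral)
    finally have "d ^ 5 / q \<le> 0" by (simp add: power_mult[symmetric])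
    moreover have "d ^ 5 / q > 0" using d q by simp
    ultimately show False by linarith
  qed
  show ?thesis using SX cardS rep by blast
qed

section \<open>Size of spans over a finite field\<close>

lemma finite_span_finite:
  fixes scale :: "'k::{finite,field} \<Rightarrow> 'b::ab_group_add \<Rightarrow> 'b"
  assumes "vector_space scale" "finite X"
  shows "finite (module.span scale X)"
proof -
  interpret vector_space scale by fact
  show ?thesis using assms(2)
  proof induction
    case (insert a S)
    have "span (insert a S) \<subseteq> (\<lambda>(k, y). y + scale k a) ` (UNIV \<times> span S)"
      by (force simp: span_insert)
    moreover have "finite \<dots>" using insert by (intro finite_imageI finite_SigmaI) auto
    ultimately show ?case by (rule finite_subset)
  qed simp
qed

text \<open>The stage \<open>Y n\<close> collects the linear combinations with n terms. An infinite
  \<open>|X|\<close> absorbs the finite field of coefficients, the finite products and the union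
  over all n.\<close>

lemma card_of_span_le:
  fixes scale :: "'k::{finite,field} \<Rightarrow> 'b::ab_group_add \<Rightarrow> 'b"
  assumes "vector_space scale" "infinite X"
  shows "|module.span scale X| \<le>o |X|"
proof -
  interpret vector_space scale by fact
  define Y where "Y = rec_nat {0} (\<lambda>_ Y. (\<lambda>(k, a, y). scale k a + y) ` (UNIV \<times> X \<times> Y))"
  have Y0: "Y 0 = {0}" and YS: "Y (Suc n) = (\<lambda>(k, a, y). scale k a + y) ` (UNIV \<times> X \<times> Y n)" for n
    by (simp_all add: Y_def)
  have Y: "|Y n| \<le>o |X|" for n
  proof (induction n)
    case 0
    have "X \<noteq> {}" using assms(2) by auto
    thus ?case unfolding Y0 by (rule card_of_singl_ordLeq)
  next
    case (Suc n)
    have fin: "|UNIV :: 'k set| \<le>o |X|"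
      using assms(2) by (intro ordLeq3_finite_infinite) auto
    have "|X \<times> Y n| \<le>o |X|"
      by (rule card_of_Sigma_ordLeq_infinite[OF assms(2)]) (auto simp: Suc ordLeq_refl card_of_Card_order)
    hence "|(UNIV :: 'k set) \<times> X \<times> Y n| \<le>o |X|"
      by (intro card_of_Sigma_ordLeq_infinite[OF assms(2) fin] ballI)
    thus ?case unfolding YS using card_of_image ordLeq_transitive by blast
  qed
  have "span X \<subseteq> (\<Union>n. Y n)"
  proof
    fix x assume "x \<in> span X"
    thus "x \<in> (\<Union>n. Y n)"
    proof (induction rule: span_induct_alt)
      case base
      thus ?case using Y0 by blast
    next
      case (step c a y)
      then obtain n where "y \<in> Y n" by blast
      hence "scale c a + y \<in> Y (Suc n)" unfolding YS using step by force
      thus ?case by blast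
    qed
  qed
  moreover have "|\<Union>n. Y n| \<le>o |X|"
    by (rule card_of_UNION_ordLeq_infinite[OF assms(2)])
       (use assms(2) Y in \<open>auto simp: infinite_iff_card_of_nat\<close>)
  ultimately show ?thesis using card_of_mono1 ordLeq_transitive by blast
qed

section \<open>The algebraic dual and annihilators\<close>

definition fun_scale :: "'k::field \<Rightarrow> ('a \<Rightarrow> 'k) \<Rightarrow> 'a \<Rightarrow> 'k" where
  "fun_scale c \<phi> = (\<lambda>x. c * \<phi> x)"

lemma fun_scale_apply: "fun_scale c \<phi> x = c * \<phi> x"
  by (simp add: fun_scale_def)

lemma vector_space_fun_scale: "vector_space fun_scale"
  by standard (auto simp: fun_scale_apply fun_eq_iff algebra_simps)

definition annihilator :: "('a \<Rightarrow> 'k::zero) set \<Rightarrow> 'a set" where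
  "annihilator S = {x. \<forall>\<phi>\<in>S. \<phi> x = 0}"

lemma annihilator_antimono: "S \<subseteq> T \<Longrightarrow> annihilator T \<subseteq> annihilator S"
  by (auto simp: annihilator_def)

locale fp_space = vector_space smul
  for smul :: "'p::prime_card mod_ring \<Rightarrow> 'a::ab_group_add \<Rightarrow> 'a"
begin

sublocale fn: vector_space "fun_scale :: 'p mod_ring \<Rightarrow> ('a \<Rightarrow> 'p mod_ring) \<Rightarrow> _"
  by (rule vector_space_fun_scale)

sublocale functional: vector_space_pair smul "(*) :: 'p mod_ring \<Rightarrow> _"
  by unfold_locales (auto simp: algebra_simps)

definition dual :: "('a \<Rightarrow> 'p mod_ring) set" where
  "dual = {\<phi>. Vector_Spaces.linear smul (*) \<phi>}"

lemma dual_iff: "\<phi> \<in> dual \<longleftrightarrow> (\<forall>x y. \<phi> (x + y) = \<phi> x + \<phi> y) \<and> (\<forall>c x. \<phi> (smul c x) = c * \<phi> x)"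
  unfolding dual_def mem_Collect_eq Vector_Spaces.linear_iff
  using vector_space_axioms functional.vs2.vector_space_axioms by blast

lemma
  assumes "\<phi> \<in> dual"
  shows dual_add: "\<phi> (x + y) = \<phi> x + \<phi> y" and dual_scale: "\<phi> (smul c x) = c * \<phi> x"
    and dual_zero: "\<phi> 0 = 0" and dual_diff: "\<phi> (x - y) = \<phi> x - \<phi> y"
proof -
  have *: "Vector_Spaces.linear smul (*) \<phi>" using assms by (simp add: dual_def)
  show "\<phi> (x + y) = \<phi> x + \<phi> y" "\<phi> (smul c x) = c * \<phi> x" "\<phi> 0 = 0" "\<phi> (x - y) = \<phi> x - \<phi> y"
    by (fact functional.linear_add[OF *] functional.linear_scale[OF *] functional.linear_0[OF *]
      functional.linear_diff[OF *])+
qed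

lemma subspace_dual: "fn.subspace dual"
proof (rule fn.subspaceI)
  show "0 \<in> dual" by (simp add: dual_iff)
  show "\<phi> + \<psi> \<in> dual" if "\<phi> \<in> dual" "\<psi> \<in> dual" for \<phi> \<psi>
    unfolding dual_iff using that by (simp add: dual_add dual_scale distrib_left)
  show "fun_scale c \<phi> \<in> dual" if "\<phi> \<in> dual" for c \<phi>
    unfolding dual_iff fun_scale_apply using that
    by (simp add: dual_add dual_scale distrib_left mult.left_commute)
qed

lemma span_dual: "S \<subseteq> dual \<Longrightarrow> fn.span S \<subseteq> dual"
  by (rule fn.span_minimal[OF _ subspace_dual])

lemma subspace_annihilator: "S \<subseteq> dual \<Longrightarrow> subspace (annihilator S)"
  by (rule subspaceI) (auto simp: annihilator_def dual_add dual_scale dual_zero subset_iff)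

text \<open>Finite duality, by elimination of one functional at a time. If \<open>\<phi>\<close> is
  not already zero on \<open>annihilator S\<close>, take \<open>z\<close> there with
  \<open>\<phi> z \<noteq> 0\<close> and subtract from \<open>\<psi>\<close> the multiple of
  \<open>\<phi>\<close> that agrees with it at \<open>z\<close>. The result vanishes on
  \<open>annihilator S\<close>, because each of its elements becomes a zero of \<open>\<phi>\<close>
  after subtracting a multiple of \<open>z\<close>.\<close>

lemma in_span_if_vanishes_on_annihilator:
  assumes "finite S" "S \<subseteq> dual" "\<psi> \<in> dual" "\<And>x. x \<in> annihilator S \<Longrightarrow> \<psi> x = 0"
  shows "\<psi> \<in> fn.span S"
  using assms
proof (induction S arbitrary: \<psi>)
  case empty
  hence "\<psi> = 0" by (auto simp: annihilator_def fun_eq_iff)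
  thus ?case using fn.span_zero by metis
next
  case (insert \<phi> S)
  have \<phi>: "\<phi> \<in> dual" using insert by simp
  show ?case
  proof (cases "\<forall>x\<in>annihilator S. \<phi> x = 0")
    case True
    hence "annihilator S \<subseteq> annihilator (insert \<phi> S)" by (auto simp: annihilator_def)
    hence "\<psi> \<in> fn.span S" using insert by blast
    thus ?thesis using fn.span_mono[of S "insert \<phi> S"] by blast
  next
    case False
    then obtain z where z: "z \<in> annihilator S" "\<phi> z \<noteq> 0" by blast
    define \<psi>' where "\<psi>' = \<psi> - fun_scale (\<psi> z / \<phi> z) \<phi>"
    have "\<psi>' \<in> fn.span S"
    proof (rule insert.IH)
      show "\<psi>' \<in> dual" unfolding \<psi>'_def
        using insert.prems subspace_dual by (simp add: fn.subspace_diff fn.subspace_scale)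
      fix x assume x: "x \<in> annihilator S"
      have "x - smul (\<phi> x / \<phi> z) z \<in> annihilator (insert \<phi> S)"
        using x z insert.prems \<phi> 
        by (auto simp: annihilator_def dual_diff dual_scale subset_iff)
      hence "\<psi> (x - smul (\<phi> x / \<phi> z) z) = 0" using insert.prems by blast
      thus "\<psi>' x = 0" using insert.prems(2) z
        by (simp add: \<psi>'_def fun_scale_apply dual_diff dual_scale)
    qed (use insert in auto)
    hence "\<psi>' + fun_scale (\<psi> z / \<phi> z) \<phi> \<in> fn.span (insert \<phi> S)"
      by (meson fn.span_add fn.span_base fn.span_mono fn.span_scale insertI1 subsetD subset_insertI)
    thus ?thesis by (simp add: \<psi>'_def)
  qed
qed

text \<open>A basis of \<open>K\<close> stays independent when \<open>x\<close> is added, so there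
  is a functional that is 1 at \<open>x\<close> and 0 on that basis.\<close>

lemma dual_separates:
  assumes K: "subspace K" and x: "x \<notin> K"
  shows "\<exists>\<psi>\<in>dual. (\<forall>y\<in>K. \<psi> y = 0) \<and> \<psi> x \<noteq> 0"
proof -
  obtain C where C: "C \<subseteq> K" "independent C" "K \<subseteq> span C"
    using maximal_independent_subset by blast
  have spanC: "span C = K" using C K by (simp add: span_subspace)
  hence ind: "independent (insert x C)" using x C by (simp add: independent_insertI)
  obtain \<psi> where \<psi>: "Vector_Spaces.linear smul (*) \<psi>"
    "\<forall>y\<in>insert x C. \<psi> y = (if y = x then 1 else 0 :: 'p mod_ring)"
    using functional.linear_independent_extend[OF ind, of "\<lambda>y. if y = x then 1 else 0"] by blast
  have "x \<notin> C" using x C by blast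
  hence "\<psi> y = 0" if "y \<in> C" for y using that \<psi>(2) by auto
  hence "\<psi> y = 0" if "y \<in> K" for y
    using functional.linear_eq_0_on_span[OF \<psi>(1)] that spanC by blast
  thus ?thesis using \<psi> by (auto simp: dual_def)
qed

text \<open>Modulo the annihilator a vector is determined by its tuple of values on
  \<open>S\<close>, and there are finitely many such tuples over a finite field. \<open>G\<close>
  picks one vector for each tuple that occurs.\<close>

lemma annihilator_finite_index:
  fixes S :: "('a \<Rightarrow> 'p mod_ring) set"
  assumes S: "finite S" "S \<subseteq> dual"
  shows "\<exists>G. finite G \<and> (\<forall>x. \<exists>g\<in>G. x - g \<in> annihilator S)"
proof -
  define f where "f x = restrict (\<lambda>\<phi>. \<phi> x) S" for x :: 'a
  have "f ` UNIV \<subseteq> S \<rightarrow>\<^sub>E UNIV" by (auto simp: f_def)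
  moreover have "finite (S \<rightarrow>\<^sub>E (UNIV :: 'p mod_ring set))" using S by (simp add: finite_PiE)
  ultimately have "finite (f ` UNIV)" using finite_subset by blast
  then obtain G where G: "finite G" "f ` UNIV = f ` G"
    using finite_subset_image[of "f ` UNIV" f UNIV] by blast
  have "\<exists>g\<in>G. x - g \<in> annihilator S" for x
  proof -
    obtain g where g: "g \<in> G" "f x = f g" using G by blast
    hence "\<phi> x = \<phi> g" if "\<phi> \<in> S" for \<phi> using that by (metis f_def restrict_apply')
    thus ?thesis using g S by (auto simp: annihilator_def dual_diff subset_iff)
  qed
  thus ?thesis using G by blast
qed

lemma dual_eqI:
  assumes "\<phi> \<in> dual" "\<psi> \<in> dual" "\<And>x. x \<in> C \<Longrightarrow> \<phi> x = \<psi> x" "x \<in> span C"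
  shows "\<phi> x = \<psi> x"
  using functional.linear_eq_on[of \<phi> \<psi> x C] assms by (auto simp: dual_def)

end

section \<open>From finite-dimensional subspaces to the whole space by compactness\<close>

lemma closedin_product_discrete:
  assumes "finite J" and "\<And>c c'. c \<in> Z \<Longrightarrow> (\<And>j. j \<in> J \<Longrightarrow> c j = c' j) \<Longrightarrow> c' \<in> Z"
  shows "closedin (product_topology (\<lambda>_. discrete_topology UNIV) UNIV) Z"
proof -
  let ?T = "product_topology (\<lambda>_. discrete_topology UNIV) UNIV"
  have "openin ?T (- Z)"
  proof (subst openin_subopen, intro ballI)
    fix c assume c: "c \<in> - Z"
    define N where "N = (\<Pi>\<^sub>E j\<in>UNIV. if j \<in> J then {c j} else UNIV)"
    have "openin ?T N" unfolding N_def
      by (subst openin_PiE_gen) (auto simp: assms(1) intro: finite_subset[OF _ assms(1)] split: if_splits)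
    moreover have "c \<in> N" by (auto simp: N_def)
    moreover have "N \<subseteq> - Z"
    proof
      fix c' assume "c' \<in> N"
      hence "\<And>j. j \<in> J \<Longrightarrow> c' j = c j" by (auto simp: N_def PiE_iff split: if_splits)
      thus "c' \<in> - Z" using assms(2) c by blast
    qed
    ultimately show "\<exists>T. openin ?T T \<and> c \<in> T \<and> T \<subseteq> - Z" by blast
  qed
  thus ?thesis by (simp add: closedin_def Compl_eq_Diff_UNIV)
qed

context fp_space begin

text \<open>A point \<open>c\<close> of a product of finite discrete spaces encodes k^2 functionals
  through their values on a basis, where k is the number of translates. The points that work on
  \<open>span b\<close> form a closed set \<open>Z b\<close>, nonempty by the finite case, and
  compactness yields one point for all finite \<open>b\<close>. A single product space suffices
  because k^2 does not depend on \<open>b\<close>.\<close>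

lemma bogolyubov:
  assumes G: "finite G" "\<And>x. \<exists>g\<in>G. x - g \<in> V"
  shows "\<exists>S. finite S \<and> S \<subseteq> dual \<and>
    annihilator S \<subseteq> twofold_difference V"
proof -
  define Q where "Q = twofold_difference V"
  obtain B where B: "independent B" "span B = UNIV"
    using basis_exists[of UNIV] by (metis UNIV_I span_UNIV subset_UNIV subset_antisym)
  define k where "k = card G"
  have k: "k > 0" using G by (auto simp: k_def card_gt_0_iff)
  define L where "L i c = functional.construct B (\<lambda>v. c (i, v))" for i :: nat and c :: "nat \<times> 'a \<Rightarrow> 'p mod_ring"
  have L_dual: "L i c \<in> dual" for i c
    by (simp add: dual_def L_def functional.linear_construct[OF B(1)])
  have L_basis: "L i c v = c (i, v)" if "v \<in> B" for i c v
    using that by (simp add: L_def functional.construct_basis[OF B(1)])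
  define Z where "Z b = {c. \<forall>x\<in>span b. (\<forall>i<k\<^sup>2. L i c x = 0) \<longrightarrow> x \<in> Q}" for b
  have closed: "closedin (product_topology (\<lambda>_. discrete_topology UNIV) UNIV) (Z b)"
    if b: "finite b" "b \<subseteq> B" for b
  proof (rule closedin_product_discrete[of "{..<k\<^sup>2} \<times> b"])
    fix c c' assume c: "c \<in> Z b" "\<And>j. j \<in> {..<k\<^sup>2} \<times> b \<Longrightarrow> c j = c' j"
    have "L i c x = L i c' x" if "i < k\<^sup>2" "x \<in> span b" for i x
      by (rule dual_eqI[OF L_dual L_dual _ that(2)])
         (use b that c(2) in \<open>auto simp: L_basis subset_iff\<close>)
    thus "c' \<in> Z b" using c(1) by (auto simp: Z_def)
  qed (use b in auto)
  have nonempty: "Z b \<noteq> {}" if b: "finite b" "b \<subseteq> B" for b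
  proof -
    define E where "E = span b"
    \<comment> \<open>These are the functionals on \<open>span b\<close>, each extended by 0 to the
      remaining basis vectors; so \<open>X\<close> is finite and is the full dual of
      \<open>E\<close>.\<close>
    define X where "X = {\<phi>\<in>dual. \<forall>v\<in>B - b. \<phi> v = 0}"
    have finE: "finite E" unfolding E_def
      by (rule finite_span_finite[OF vector_space_axioms b(1)])
    have "X \<subseteq> functional.construct B ` {f. (\<forall>v. v \<in> b \<longrightarrow> f v \<in> UNIV) \<and> (\<forall>v. v \<notin> b \<longrightarrow> f v = 0)}"
    proof
      fix \<phi> assume \<phi>: "\<phi> \<in> X"
      define f where "f v = (if v \<in> b then \<phi> v else 0)" for v
      have "functional.construct B f x = \<phi> x" for x
        by (rule dual_eqI[of _ _ B])
           (use \<phi> B in \<open>auto simp: dual_def X_def f_def functional.linear_construct functional.construct_basis\<close>)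
      hence "\<phi> = functional.construct B f" by auto
      thus "\<phi> \<in> functional.construct B ` {f. (\<forall>v. v \<in> b \<longrightarrow> f v \<in> UNIV) \<and> (\<forall>v. v \<notin> b \<longrightarrow> f v = 0)}"
        by (auto simp: f_def)
    qed
    hence finX: "finite X"
      by (rule finite_subset)
         (use finite_set_of_finite_funs[OF b(1) finite_class.finite_UNIV, of 0] in
           \<open>simp only: all_conj_distrib, intro finite_imageI, simp\<close>)
    define D where "D g = E \<inter> (\<lambda>v. g + v) ` V" for g
    \<comment> \<open>Pigeonhole: the \<open>k\<close> sets \<open>D g\<close> cover
      \<open>E\<close>. They come from translates of \<open>V\<close>, which is harmless because
      \<open>g\<close> cancels in \<open>twofold_difference\<close>.\<close>
    have "\<exists>g\<in>G. card E \<le> k * card (D g)"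
    proof (rule ccontr)
      assume "\<not> ?thesis"
      hence *: "k * card (D g) < card E" if "g \<in> G" for g using that by auto
      have "x \<in> (\<Union>g\<in>G. D g)" if x: "x \<in> E" for x
      proof -
        obtain g where "g \<in> G" "x - g \<in> V" using G by blast
        thus ?thesis using x by (force simp: D_def)
      qed
      hence "card E \<le> card (\<Union>g\<in>G. D g)"
        by (intro card_mono) (use G finE in \<open>auto simp: D_def\<close>)
      also have "\<dots> \<le> (\<Sum>g\<in>G. card (D g))" using G by (intro card_UN_le)
      finally have "k * card E \<le> (\<Sum>g\<in>G. k * card (D g))" by (simp flip: sum_distrib_left)
      also have "\<dots> < (\<Sum>g\<in>G. card E)" using G k by (intro sum_strict_mono *) (auto simp: k_def)
      finally show False by (simp add: k_def)
    qed
    then obtain g where g: "g \<in> G" "card E \<le> k * card (D g)" by blast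
    have "\<exists>S\<subseteq>X. card S \<le> k\<^sup>2 \<and> (\<forall>x\<in>E. (\<forall>\<phi>\<in>S. \<phi> x = 0) \<longrightarrow>
      x \<in> twofold_difference (D g))"
    proof (rule bogolyubov_finite[OF finE finX])
      show "0 \<in> E" by (simp add: E_def span_zero)
      show "x - y \<in> E" if "x \<in> E" "y \<in> E" for x y using that by (simp add: E_def span_diff)
      show "0 \<in> X" using fn.subspace_0[OF subspace_dual] by (simp only: X_def) simp
      show "\<phi> - \<psi> \<in> X" if "\<phi> \<in> X" "\<psi> \<in> X" for \<phi> \<psi>
        using that subspace_dual by (auto simp: X_def fn.subspace_diff)
      show "\<phi> (x - y) = \<phi> x - \<phi> y" if "\<phi> \<in> X" for \<phi> x y
        using that by (simp add: X_def dual_diff)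
      show "\<exists>x\<in>E. \<phi> x \<noteq> 0" if "\<phi> \<in> X" "\<phi> \<noteq> 0" for \<phi>
      proof (rule ccontr)
        assume no: "\<not> ?thesis"
        have "\<phi> v = 0 v" if "v \<in> B" for v
          using that no \<open>\<phi> \<in> X\<close> span_base[of v b] by (cases "v \<in> b") (auto simp: X_def E_def)
        moreover have "\<phi> \<in> dual" "0 \<in> dual" "x \<in> span B" for x
          using \<open>\<phi> \<in> X\<close> B fn.subspace_0[OF subspace_dual] by (simp_all only: X_def mem_Collect_eq UNIV_I)
        ultimately have "\<phi> = 0" using dual_eqI by (intro ext) blast
        thus False using that by blast
      qed
      show "\<exists>\<phi>\<in>X. \<phi> x \<noteq> 0" if x: "x \<in> E" "x \<noteq> 0" for x
      proof -
        obtain \<psi> where \<psi>: "\<psi> \<in> dual" "\<psi> x \<noteq> 0"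
          using dual_separates[OF subspace_single_0, of x] x by auto
        define \<phi> where "\<phi> = functional.construct B (\<lambda>v. if v \<in> b then \<psi> v else 0)"
        have \<phi>: "\<phi> \<in> dual" "\<And>v. v \<in> B \<Longrightarrow> \<phi> v = (if v \<in> b then \<psi> v else 0)"
          by (simp_all add: dual_def \<phi>_def functional.linear_construct functional.construct_basis B)
        have "\<phi> x = \<psi> x"
          by (rule dual_eqI[of _ _ b]) (use \<phi> \<psi> b x in \<open>auto simp: E_def subset_iff\<close>)
        thus ?thesis using \<phi> \<psi> by (auto simp: X_def)
      qed
    qed (use g in \<open>auto simp: D_def\<close>)
    then obtain S where S: "S \<subseteq> X" "card S \<le> k\<^sup>2" and rep: "\<And>x. x \<in> E \<Longrightarrow> (\<forall>\<phi>\<in>S. \<phi> x = 0) \<Longrightarrow>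
      x \<in> twofold_difference (D g)"
      by blast
    have "finite S" using S finX finite_subset by blast
    then obtain f where f: "bij_betw f {..<card S} S"
      using ex_bij_betw_nat_finite by (metis atLeast0LessThan)
    \<comment> \<open>The set \<open>S\<close> may have fewer than k^2 elements; the remaining slots
      are filled with the zero functional.\<close>
    define c where "c = (\<lambda>(i, v). if i < card S then f i v else 0)"
    have "c \<in> Z b" unfolding Z_def
    proof safe
      fix x assume x: "x \<in> span b" "\<forall>i<k\<^sup>2. L i c x = 0"
      have zero: "L i c x = 0" if "i < card S" for i
        using x(2) that S(2) by simp
      have "\<phi> x = 0" if "\<phi> \<in> S" for \<phi>
      proof -
        have "\<phi> \<in> f ` {..<card S}" using that bij_betw_imp_surj_on[OF f] by simp
        then obtain i where i: "i < card S" "\<phi> = f i" by blast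
        have "L i c x = \<phi> x"
        proof (rule dual_eqI[of _ _ B])
          show "L i c \<in> dual" by (rule L_dual)
          show "\<phi> \<in> dual" using that S by (auto simp: X_def)
          show "L i c v = \<phi> v" if "v \<in> B" for v
            using L_basis[OF that, of i c] i by (simp add: c_def)
          show "x \<in> span B" using B by simp
        qed
        thus ?thesis using zero[OF i(1)] by simp
      qed
      then obtain u v w z where *: "u \<in> D g" "v \<in> D g" "w \<in> D g" "z \<in> D g" "x = u + v - (w + z)"
        using rep x unfolding E_def twofold_difference_def by blast
      obtain u' v' w' z' where "u = g + u'" "v = g + v'" "w = g + w'" "z = g + z'"
        "u' \<in> V" "v' \<in> V" "w' \<in> V" "z' \<in> V" using * by (auto simp: D_def)
      moreover from this have "x = u' + v' - (w' + z')" using * by (simp add: algebra_simps)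
      ultimately show "x \<in> Q" unfolding Q_def twofold_difference_def by blast
    qed
    thus ?thesis by blast
  qed
  let ?\<U> = "Z ` {b. finite b \<and> b \<subseteq> B}"
  have "\<Inter>?\<U> \<noteq> {}"
  proof -
    have comp: "compact_space (product_topology (\<lambda>_ :: nat \<times> 'a. discrete_topology (UNIV :: 'p mod_ring set)) UNIV)"
      by (simp add: compact_space_product_topology compact_space_discrete_topology)
    have fip: "\<Inter>\<F> \<noteq> {}" if \<F>: "finite \<F>" "\<F> \<subseteq> ?\<U>" for \<F>
    proof -
      obtain \<B> where \<B>: "finite \<B>" "\<B> \<subseteq> {b. finite b \<and> b \<subseteq> B}" "\<F> = Z ` \<B>"
        using finite_subset_image[OF \<F>] by blast
      \<comment> \<open>\<open>Z\<close> is antitone and finite unions of finite sets are finite, so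
        the finite intersection property reduces to one nonempty set.\<close>
      have "Z (\<Union>\<B>) \<noteq> {}" using \<B> by (intro nonempty) auto
      moreover have "Z (\<Union>\<B>) \<subseteq> Z b" if "b \<in> \<B>" for b
        using that span_mono[of b "\<Union>\<B>"] by (auto simp: Z_def)
      ultimately show ?thesis using \<B> by blast
    qed
    show ?thesis
      by (rule comp[unfolded compact_space_fip, rule_format]) (use closed fip in auto)
  qed
  then obtain c where c: "\<And>b. finite b \<Longrightarrow> b \<subseteq> B \<Longrightarrow> c \<in> Z b" by blast
  define S where "S = (\<lambda>i. L i c) ` {..<k\<^sup>2}"
  have "x \<in> Q" if x: "x \<in> annihilator S" for x
  proof -
    have "x \<in> span B" using B by simp
    \<comment> \<open>Every vector uses only finitely many basis vectors, so the conditions for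
      finite \<open>b\<close> reach the whole space.\<close>
    then obtain b r where b: "finite b" "b \<subseteq> B" "x = (\<Sum>v\<in>b. smul (r v) v)"
      unfolding span_explicit[of B] by blast
    have xb: "x \<in> span b" unfolding b(3) by (intro span_sum span_scale span_base)
    show ?thesis using c[OF b(1,2)] x xb by (auto simp: Z_def S_def annihilator_def)
  qed
  moreover have "finite S" "S \<subseteq> dual" using L_dual by (auto simp: S_def)
  ultimately show ?thesis unfolding Q_def by blast
qed

section \<open>Topologies induced by functionals\<close>

text \<open>For \<open>W\<close> in the dual this is the initial topology of the functionals in
  \<open>W\<close> into the discrete field. It is written out through basic neighbourhoods, the
  cosets of annihilators of finite subsets of \<open>W\<close>.\<close>

definition functional_topology :: "('a \<Rightarrow> 'p mod_ring) set \<Rightarrow> 'a topology" where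
  "functional_topology W = topology (\<lambda>U. \<forall>x\<in>U. \<exists>S. finite S \<and> S \<subseteq> W \<and>
     (\<forall>y. y - x \<in> annihilator S \<longrightarrow> y \<in> U))"

lemma openin_functional_topology:
  "openin (functional_topology W) U \<longleftrightarrow>
     (\<forall>x\<in>U. \<exists>S. finite S \<and> S \<subseteq> W \<and> (\<forall>y. y - x \<in> annihilator S \<longrightarrow> y \<in> U))"
proof -
  have "istopology (\<lambda>U. \<forall>x\<in>U. \<exists>S. finite S \<and> S \<subseteq> W \<and> (\<forall>y. y - x \<in> annihilator S \<longrightarrow> y \<in> U))"
    unfolding istopology_def
  proof (intro conjI allI impI ballI)
    fix U V x
    assume U: "\<forall>x\<in>U. \<exists>S. finite S \<and> S \<subseteq> W \<and> (\<forall>y. y - x \<in> annihilator S \<longrightarrow> y \<in> U)"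
      and V: "\<forall>x\<in>V. \<exists>S. finite S \<and> S \<subseteq> W \<and> (\<forall>y. y - x \<in> annihilator S \<longrightarrow> y \<in> V)"
      and x: "x \<in> U \<inter> V"
    obtain S where S: "finite S" "S \<subseteq> W" "\<And>y. y - x \<in> annihilator S \<Longrightarrow> y \<in> U"
      using U x by blast
    obtain T where T: "finite T" "T \<subseteq> W" "\<And>y. y - x \<in> annihilator T \<Longrightarrow> y \<in> V"
      using V x by blast
    have "annihilator (S \<union> T) \<subseteq> annihilator S" "annihilator (S \<union> T) \<subseteq> annihilator T"
      by (auto simp: annihilator_def)
    hence "\<forall>y. y - x \<in> annihilator (S \<union> T) \<longrightarrow> y \<in> U \<inter> V" using S(3) T(3) by blast
    thus "\<exists>S. finite S \<and> S \<subseteq> W \<and> (\<forall>y. y - x \<in> annihilator S \<longrightarrow> y \<in> U \<inter> V)"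
      using S(1,2) T(1,2) by (intro exI[of _ "S \<union> T"]) simp
  next
    fix \<K> x
    assume K: "\<forall>K\<in>\<K>. \<forall>x\<in>K. \<exists>S. finite S \<and> S \<subseteq> W \<and> (\<forall>y. y - x \<in> annihilator S \<longrightarrow> y \<in> K)"
      and x: "x \<in> \<Union>\<K>"
    then obtain K where "K \<in> \<K>" "x \<in> K" by blast
    then obtain S where "finite S \<and> S \<subseteq> W \<and> (\<forall>y. y - x \<in> annihilator S \<longrightarrow> y \<in> K)"
      using K by meson
    thus "\<exists>S. finite S \<and> S \<subseteq> W \<and> (\<forall>y. y - x \<in> annihilator S \<longrightarrow> y \<in> \<Union>\<K>)"
      using \<open>K \<in> \<K>\<close> by (intro exI[of _ S]) auto
  qed
  thus ?thesis by (simp add: functional_topology_def)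
qed

lemma openin_annihilator_coset:
  assumes "finite S" "S \<subseteq> W" "W \<subseteq> dual"
  shows "openin (functional_topology W) {y. y - x \<in> annihilator S}"
  unfolding openin_functional_topology
proof
  fix y assume y: "y \<in> {y. y - x \<in> annihilator S}"
  have sub: "subspace (annihilator S)" using assms by (intro subspace_annihilator) auto
  have "z - x \<in> annihilator S" if "z - y \<in> annihilator S" for z
    using subspace_add[OF sub that, of "y - x"] y by simp
  thus "\<exists>S'. finite S' \<and> S' \<subseteq> W \<and> (\<forall>z. z - y \<in> annihilator S' \<longrightarrow> z \<in> {y. y - x \<in> annihilator S})"
    using assms by blast
qed

lemma topspace_functional_topology [simp]: "topspace (functional_topology W) = UNIV"
proof -
  have "openin (functional_topology W) UNIV"
    unfolding openin_functional_topology by (intro ballI exI[of _ "{}"]) simp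
  thus ?thesis using openin_subset by blast
qed

lemma linearly_invariant_functional_topology:
  assumes W: "W \<subseteq> dual"
  shows "linearly_invariant smul (functional_topology W)"
  unfolding linearly_invariant_def
proof (intro conjI)
  let ?T = "functional_topology W"
  have coset: "openin ?T {y. y - x \<in> annihilator S}" "x \<in> {y. y - x \<in> annihilator S}"
    "subspace (annihilator S)"
    if "finite S" "S \<subseteq> W" for S x
    using openin_annihilator_coset[OF that W] that W subspace_annihilator[of S]
    by (auto simp: subspace_0)
  show "continuous_map (prod_topology ?T ?T) ?T (\<lambda>(x, y). x + y)"
    unfolding continuous_map_def
  proof (intro conjI allI impI)
    fix U assume U: "openin ?T U"
    show "openin (prod_topology ?T ?T) {p \<in> topspace (prod_topology ?T ?T). (\<lambda>(x, y). x + y) p \<in> U}"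
      unfolding openin_prod_topology_alt
    proof (intro allI impI)
      fix x y assume "(x, y) \<in> {p \<in> topspace (prod_topology ?T ?T). (\<lambda>(x, y). x + y) p \<in> U}"
      hence "x + y \<in> U" by simp
      then obtain S where S: "finite S" "S \<subseteq> W" "\<And>z. z - (x + y) \<in> annihilator S \<Longrightarrow> z \<in> U"
        using U unfolding openin_functional_topology by blast
      have "x' + y' \<in> U" if "x' - x \<in> annihilator S" "y' - y \<in> annihilator S" for x' y'
        by (rule S(3)) (use subspace_add[OF coset(3)[OF S(1,2)] that] in \<open>simp add: algebra_simps\<close>)
      thus "\<exists>U1 V. openin ?T U1 \<and> openin ?T V \<and> x \<in> U1 \<and> y \<in> V \<and>
          U1 \<times> V \<subseteq> {p \<in> topspace (prod_topology ?T ?T). (\<lambda>(x, y). x + y) p \<in> U}"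
        using coset(1,2)[OF S(1,2), of x] coset(1,2)[OF S(1,2), of y]
        by (intro exI[of _ "{x'. x' - x \<in> annihilator S}"] exI[of _ "{y'. y' - y \<in> annihilator S}"]) auto
    qed
  qed simp
  let ?D = "discrete_topology UNIV :: 'p mod_ring topology"
  show "continuous_map (prod_topology ?D ?T) ?T (\<lambda>(c, x). smul c x)"
    unfolding continuous_map_def
  proof (intro conjI allI impI)
    fix U assume U: "openin ?T U"
    show "openin (prod_topology ?D ?T) {p \<in> topspace (prod_topology ?D ?T). (\<lambda>(c, x). smul c x) p \<in> U}"
      unfolding openin_prod_topology_alt
    proof (intro allI impI)
      fix c x assume "(c, x) \<in> {p \<in> topspace (prod_topology ?D ?T). (\<lambda>(c, x). smul c x) p \<in> U}"
      hence "smul c x \<in> U" by simp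
      then obtain S where S: "finite S" "S \<subseteq> W" "\<And>z. z - smul c x \<in> annihilator S \<Longrightarrow> z \<in> U"
        using U unfolding openin_functional_topology by blast
      have "smul c x' \<in> U" if "x' - x \<in> annihilator S" for x'
        by (rule S(3)) (use subspace_scale[OF coset(3)[OF S(1,2)] that, of c] in
            \<open>simp add: scale_right_diff_distrib\<close>)
      thus "\<exists>C V. openin ?D C \<and> openin ?T V \<and> c \<in> C \<and> x \<in> V \<and>
          C \<times> V \<subseteq> {p \<in> topspace (prod_topology ?D ?T). (\<lambda>(c, x). smul c x) p \<in> U}"
        using coset(1,2)[OF S(1,2), of x]
        by (intro exI[of _ "{c}"] exI[of _ "{x'. x' - x \<in> annihilator S}"]) auto
    qed
  qed simp
qed simp

text \<open>Total boundedness comes from the finite index of annihilators of finite sets. Two points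
  are separated by two different cosets of the kernel of one functional in \<open>W\<close>.\<close>

lemma functional_topology_tbh:
  assumes W: "W \<subseteq> dual" and sep: "annihilator W = {0}"
  shows "functional_topology W \<in> tbh_topologies smul"
proof -
  let ?T = "functional_topology W"
  have "totally_bounded_top ?T"
    unfolding totally_bounded_top_def
  proof (intro allI impI, elim exE conjE)
    fix U V assume V: "openin ?T V" "0 \<in> V" "V \<subseteq> U"
    then obtain S where S: "finite S" "S \<subseteq> W" "annihilator S \<subseteq> V"
      unfolding openin_functional_topology by force
    obtain G where G: "finite G" "\<And>x. \<exists>g\<in>G. x - g \<in> annihilator S"
      using annihilator_finite_index[of S] S W by blast
    have "x \<in> (\<Union>g\<in>insert 0 G. (\<lambda>x. g + x) ` U)" for x
    proof -
      obtain g where g: "g \<in> G" "x - g \<in> U" using G(2)[of x] S V by blast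
      hence "x \<in> (\<lambda>x. g + x) ` U" by (intro image_eqI[of _ _ "x - g"]) auto
      thus ?thesis using g by blast
    qed
    thus "\<exists>G. finite G \<and> (\<Union>g\<in>insert 0 G. (\<lambda>x. g + x) ` U) = UNIV"
      using G(1) by blast
  qed
  moreover have "Hausdorff_space ?T"
    unfolding Hausdorff_space_def
  proof (intro allI impI)
    fix x y assume "x \<in> topspace ?T \<and> y \<in> topspace ?T \<and> x \<noteq> y"
    hence "x - y \<notin> annihilator W" using sep by auto
    then obtain \<phi> where \<phi>: "\<phi> \<in> W" "\<phi> (x - y) \<noteq> 0" by (auto simp: annihilator_def)
    have eq: "\<phi> (z - z') = \<phi> z - \<phi> z'" for z z' using \<phi>(1) W dual_diff by blast
    hence "\<phi> x \<noteq> \<phi> y" using \<phi>(2) by simp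
    moreover have "openin ?T {z. z - x \<in> annihilator {\<phi>}}" "openin ?T {z. z - y \<in> annihilator {\<phi>}}"
      using openin_annihilator_coset[of "{\<phi>}"] \<phi> W by auto
    ultimately show "\<exists>U V. openin ?T U \<and> openin ?T V \<and> x \<in> U \<and> y \<in> V \<and> disjnt U V"
      by (intro exI[of _ "{z. z - x \<in> annihilator {\<phi>}}"] exI[of _ "{z. z - y \<in> annihilator {\<phi>}}"])
         (auto simp: annihilator_def disjnt_iff eq)
  qed
  ultimately show ?thesis
    using linearly_invariant_functional_topology[OF W] by (simp add: tbh_topologies_def)
qed

section \<open>Neighbourhoods of zero and continuous functionals\<close>

lemma
  assumes \<tau>: "linearly_invariant smul \<tau>"
  shows linearly_invariant_nhd_add: "openin \<tau> U \<Longrightarrow> 0 \<in> U \<Longrightarrow>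
      \<exists>V. openin \<tau> V \<and> 0 \<in> V \<and> (\<forall>x\<in>V. \<forall>y\<in>V. x + y \<in> U)"
    and linearly_invariant_openin_translate: "openin \<tau> U \<Longrightarrow> openin \<tau> {x. a + x \<in> U}"
    and linearly_invariant_openin_scale: "openin \<tau> U \<Longrightarrow> openin \<tau> {x. smul c x \<in> U}"
proof -
  have top: "topspace \<tau> = UNIV"
    and add: "continuous_map (prod_topology \<tau> \<tau>) \<tau> (\<lambda>(x, y). x + y)"
    and scale: "continuous_map (prod_topology (discrete_topology UNIV) \<tau>) \<tau> (\<lambda>(c, x). smul c x)"
    using \<tau> by (auto simp: linearly_invariant_def)
  show "\<exists>V. openin \<tau> V \<and> 0 \<in> V \<and> (\<forall>x\<in>V. \<forall>y\<in>V. x + y \<in> U)" if U: "openin \<tau> U" "0 \<in> U"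
  proof -
    have "openin (prod_topology \<tau> \<tau>) {p \<in> topspace (prod_topology \<tau> \<tau>). (\<lambda>(x, y). x + y) p \<in> U}"
      using add U unfolding continuous_map_def by blast
    moreover have "(0, 0) \<in> {p \<in> topspace (prod_topology \<tau> \<tau>). (\<lambda>(x, y). x + y) p \<in> U}"
      using U top by simp
    ultimately obtain V1 V2 where V: "openin \<tau> V1" "openin \<tau> V2" "0 \<in> V1" "0 \<in> V2"
      "V1 \<times> V2 \<subseteq> {p \<in> topspace (prod_topology \<tau> \<tau>). (\<lambda>(x, y). x + y) p \<in> U}"
      unfolding openin_prod_topology_alt by meson
    have "x + y \<in> U" if "x \<in> V1 \<inter> V2" "y \<in> V1 \<inter> V2" for x y using V(5) that by auto
    thus ?thesis using V by (intro exI[of _ "V1 \<inter> V2"]) auto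
  qed
  show "openin \<tau> {x. a + x \<in> U}" if U: "openin \<tau> U"
  proof -
    have "continuous_map \<tau> (prod_topology \<tau> \<tau>) (\<lambda>x. (a, x))"
      by (simp add: continuous_map_pairwise o_def top)
    hence "continuous_map \<tau> \<tau> (\<lambda>x. a + x)"
      using continuous_map_compose[OF _ add, of \<tau> "\<lambda>x. (a, x)"] by (simp add: o_def)
    thus ?thesis using U top by (simp add: continuous_map_def)
  qed
  show "openin \<tau> {x. smul c x \<in> U}" if U: "openin \<tau> U"
  proof -
    have "continuous_map \<tau> (prod_topology (discrete_topology UNIV) \<tau>) (\<lambda>x. (c, x))"
      by (simp add: continuous_map_pairwise o_def top)
    hence "continuous_map \<tau> \<tau> (\<lambda>x. smul c x)"
      using continuous_map_compose[OF _ scale, of \<tau> "\<lambda>x. (c, x)"] by (simp add: o_def)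
    thus ?thesis using U top by (simp add: continuous_map_def)
  qed
qed

lemma linearly_invariant_nhd_diff:
  assumes \<tau>: "linearly_invariant smul \<tau>" and U: "openin \<tau> U" "0 \<in> U"
  shows "\<exists>V. openin \<tau> V \<and> 0 \<in> V \<and> (\<forall>x\<in>V. \<forall>y\<in>V. x - y \<in> U)"
proof -
  obtain V where V: "openin \<tau> V" "0 \<in> V" "\<forall>x\<in>V. \<forall>y\<in>V. x + y \<in> U"
    using linearly_invariant_nhd_add[OF \<tau> U] by blast
  have "{x. smul (- 1) x \<in> V} = {x. - x \<in> V}" by simp
  hence "openin \<tau> {x. - x \<in> V}"
    using linearly_invariant_openin_scale[OF \<tau> V(1), of "- 1"] by simp
  hence "openin \<tau> (V \<inter> {x. - x \<in> V})" using V by blast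
  moreover have "x - y \<in> U" if "x \<in> V" "- y \<in> V" for x y using V(3) that by force
  ultimately show ?thesis using V(2) by (intro exI[of _ "V \<inter> {x. - x \<in> V}"]) auto
qed

lemma linearly_invariant_nhd_twofold_difference:
  assumes \<tau>: "linearly_invariant smul \<tau>" and U: "openin \<tau> U" "0 \<in> U"
  shows "\<exists>V. openin \<tau> V \<and> 0 \<in> V \<and> twofold_difference V \<subseteq> U"
proof -
  obtain U' where U': "openin \<tau> U'" "0 \<in> U'" "\<forall>x\<in>U'. \<forall>y\<in>U'. x - y \<in> U"
    using linearly_invariant_nhd_diff[OF \<tau> U] by blast
  obtain V where V: "openin \<tau> V" "0 \<in> V" "\<forall>x\<in>V. \<forall>y\<in>V. x + y \<in> U'"
    using linearly_invariant_nhd_add[OF \<tau> U'(1,2)] by blast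
  have "twofold_difference V \<subseteq> U"
    using V(3) U'(3) by (auto simp: twofold_difference_def)
  thus ?thesis using V(1,2) by blast
qed

text \<open>The translates of \<open>V\<close> by elements of \<open>K\<close> stay inside
  \<open>K\<close>. It makes a functional continuous once its kernel contains a neighbourhood of
  zero.\<close>

lemma linearly_invariant_open_subspace:
  assumes \<tau>: "linearly_invariant smul \<tau>" and K: "subspace K"
    and V: "openin \<tau> V" "0 \<in> V" "V \<subseteq> K"
  shows "openin \<tau> K"
proof (subst openin_subopen, intro ballI)
  fix x assume x: "x \<in> K"
  have "y \<in> K" if "- x + y \<in> V" for y
    using subspace_add[OF K x, of "- x + y"] that V by auto
  thus "\<exists>T. openin \<tau> T \<and> x \<in> T \<and> T \<subseteq> K"
    using linearly_invariant_openin_translate[OF \<tau> V(1), of "- x"] V(2)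
    by (intro exI[of _ "{y. - x + y \<in> V}"]) auto
qed

text \<open>For a linearly invariant topology an open kernel amounts to continuity into the discrete
  field, since all fibres are empty or translates of the kernel.\<close>

definition continuous_dual :: "'a topology \<Rightarrow> ('a \<Rightarrow> 'p mod_ring) set" where
  "continuous_dual \<tau> = {\<phi> \<in> dual. openin \<tau> {x. \<phi> x = 0}}"

lemma subspace_kernel: "\<phi> \<in> dual \<Longrightarrow> subspace {x. \<phi> x = 0}"
  by (rule subspaceI) (auto simp: dual_zero dual_add dual_scale)

lemma subspace_continuous_dual:
  assumes \<tau>: "linearly_invariant smul \<tau>"
  shows "fn.subspace (continuous_dual \<tau>)"
proof (rule fn.subspaceI)
  have "topspace \<tau> = UNIV" using \<tau> by (simp add: linearly_invariant_def)
  hence "openin \<tau> UNIV" by (metis openin_topspace)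
  thus "0 \<in> continuous_dual \<tau>"
    using fn.subspace_0[OF subspace_dual] by (simp add: continuous_dual_def)
  fix \<phi> assume \<phi>: "\<phi> \<in> continuous_dual \<tau>"
  show "\<phi> + \<psi> \<in> continuous_dual \<tau>" if \<psi>: "\<psi> \<in> continuous_dual \<tau>" for \<psi>
  proof -
    have d: "\<phi> + \<psi> \<in> dual"
      using \<phi> \<psi> fn.subspace_add[OF subspace_dual] by (simp add: continuous_dual_def)
    have "openin \<tau> ({x. \<phi> x = 0} \<inter> {x. \<psi> x = 0})"
      using \<phi> \<psi> unfolding continuous_dual_def by blast
    hence "openin \<tau> {x. (\<phi> + \<psi>) x = 0}"
      by (rule linearly_invariant_open_subspace[OF \<tau> subspace_kernel[OF d]])
         (use \<phi> \<psi> in \<open>auto simp: continuous_dual_def dual_zero\<close>)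
    thus ?thesis using d by (simp add: continuous_dual_def)
  qed
  show "fun_scale c \<phi> \<in> continuous_dual \<tau>" for c
  proof -
    have d: "fun_scale c \<phi> \<in> dual"
      using \<phi> fn.subspace_scale[OF subspace_dual] by (simp add: continuous_dual_def)
    have "openin \<tau> {x. \<phi> x = 0}" using \<phi> by (simp add: continuous_dual_def)
    hence "openin \<tau> {x. fun_scale c \<phi> x = 0}"
      by (rule linearly_invariant_open_subspace[OF \<tau> subspace_kernel[OF d]])
         (use \<phi> in \<open>auto simp: continuous_dual_def dual_zero fun_scale_apply\<close>)
    thus ?thesis using d by (simp add: continuous_dual_def)
  qed
qed

text \<open>By Bogolyubov's theorem a neighbourhood of zero contains a subspace \<open>H\<close> of finite index.  The
  closure \<open>K\<close> of \<open>H\<close> is an open subspace, which is cut out by the finitely many functionals that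
  vanish on it.\<close>

lemma totally_bounded_nhd_contains_annihilator:
  assumes \<tau>: "linearly_invariant smul \<tau>" and tb: "totally_bounded_top \<tau>"
    and U: "openin \<tau> U" "0 \<in> U"
  shows "\<exists>S. finite S \<and> S \<subseteq> continuous_dual \<tau> \<and> annihilator S \<subseteq> U"
proof -
  have top: "topspace \<tau> = UNIV" using \<tau> by (simp add: linearly_invariant_def)
  obtain U' where U': "openin \<tau> U'" "0 \<in> U'" "\<forall>x\<in>U'. \<forall>y\<in>U'. x - y \<in> U"
    using linearly_invariant_nhd_diff[OF \<tau> U] by blast
  obtain V where V: "openin \<tau> V" "0 \<in> V" "twofold_difference V \<subseteq> U'"
    using linearly_invariant_nhd_twofold_difference[OF \<tau> U'(1,2)] by blast
  obtain G where G: "finite G" "(\<Union>g\<in>insert 0 G. (\<lambda>x. g + x) ` V) = UNIV"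
    using tb[unfolded totally_bounded_top_def, rule_format, of V] V(1,2) by blast
  have "\<exists>g\<in>insert 0 G. x - g \<in> V" for x
  proof -
    have "x \<in> (\<Union>g\<in>insert 0 G. (\<lambda>x. g + x) ` V)" using G(2) by blast
    then obtain g v where "g \<in> insert 0 G" "v \<in> V" "x = g + v" by blast
    thus ?thesis by (intro bexI[of _ g]) auto
  qed
  then obtain S where S: "finite S" "S \<subseteq> dual" "annihilator S \<subseteq> twofold_difference V"
    using bogolyubov[of "insert 0 G" V] G(1) by blast
  define H where "H = annihilator S"
  have H: "subspace H" and HU': "H \<subseteq> U'"
    using subspace_annihilator[OF S(2)] S(3) V(3) by (auto simp: H_def)
  \<comment> \<open>The closure of \<open>H\<close>: \<open>y\<close> belongs to it when every
    \<open>y + N\<close> meets \<open>H\<close>.\<close>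
  define K where "K = {y. \<forall>N. openin \<tau> N \<and> 0 \<in> N \<longrightarrow> (\<exists>h\<in>H. h - y \<in> N)}"
  have HK: "H \<subseteq> K" unfolding K_def by (auto intro!: bexI)
  have KU: "K \<subseteq> U"
  proof
    fix y assume "y \<in> K"
    then obtain h where h: "h \<in> H" "h - y \<in> U'" using U'(1,2) unfolding K_def by blast
    have "h - (h - y) \<in> U" using U'(3) h HU' by blast
    thus "y \<in> U" by simp
  qed
  have K: "subspace K"
  proof (rule subspaceI)
    show "0 \<in> K" using HK H subspace_0 by blast
    show "x + y \<in> K" if xy: "x \<in> K" "y \<in> K" for x y
      unfolding K_def
    proof (intro CollectI allI impI, elim conjE)
      fix N assume N: "openin \<tau> N" "0 \<in> N"
      obtain N' where N': "openin \<tau> N'" "0 \<in> N'" "\<forall>x\<in>N'. \<forall>y\<in>N'. x + y \<in> N"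
        using linearly_invariant_nhd_add[OF \<tau> N] by blast
      obtain h h' where h: "h \<in> H" "h - x \<in> N'" "h' \<in> H" "h' - y \<in> N'"
        using xy N'(1,2) unfolding K_def by blast
      hence "(h - x) + (h' - y) \<in> N" using N'(3) by blast
      thus "\<exists>h\<in>H. h - (x + y) \<in> N"
        using subspace_add[OF H h(1,3)] by (intro bexI[of _ "h + h'"]) (simp_all add: algebra_simps)
    qed
    show "smul c x \<in> K" if x: "x \<in> K" for c x
      unfolding K_def
    proof (intro CollectI allI impI, elim conjE)
      fix N assume N: "openin \<tau> N" "0 \<in> N"
      have "openin \<tau> {x. smul c x \<in> N}" "0 \<in> {x. smul c x \<in> N}"
        using linearly_invariant_openin_scale[OF \<tau> N(1)] N(2) by auto
      then obtain h where h: "h \<in> H" "h - x \<in> {x. smul c x \<in> N}"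
        using x unfolding K_def by blast
      thus "\<exists>h\<in>H. h - smul c x \<in> N"
        using subspace_scale[OF H] by (intro bexI[of _ "smul c h"]) (auto simp: scale_right_diff_distrib)
    qed
  qed
  obtain R where R: "finite R" "\<And>x. \<exists>g\<in>R. x - g \<in> H"
    using annihilator_finite_index[OF S(1,2)] unfolding H_def by blast
  \<comment> \<open>If \<open>g\<close> lies outside the closure \<open>K\<close>, some
    \<open>g + N\<close> misses \<open>H\<close>; for \<open>g\<close> in \<open>K\<close> any
    neighbourhood of zero serves, for instance \<open>U\<close>. Intersecting over the finitely many
    coset representatives \<open>R\<close> gives a neighbourhood of zero inside
    \<open>K\<close>.\<close>
  have "\<forall>g. \<exists>N. openin \<tau> N \<and> 0 \<in> N \<and> (g \<notin> K \<longrightarrow> (\<forall>h\<in>H. h - g \<notin> N))"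
  proof
    fix g
    show "\<exists>N. openin \<tau> N \<and> 0 \<in> N \<and> (g \<notin> K \<longrightarrow> (\<forall>h\<in>H. h - g \<notin> N))"
      using U by (cases "g \<in> K") (auto simp: K_def)
  qed
  then obtain N where N: "\<And>g. openin \<tau> (N g)" "\<And>g. 0 \<in> N g"
    "\<And>g h. g \<notin> K \<Longrightarrow> h \<in> H \<Longrightarrow> h - g \<notin> N g"
    by metis
  have "openin \<tau> (topspace \<tau> \<inter> (\<Inter>g\<in>R. N g))"
    using R(1) N(1) by (intro openin_Int_Inter) auto
  hence "openin \<tau> (\<Inter>g\<in>R. N g)" by (simp add: top)
  moreover have "(\<Inter>g\<in>R. N g) \<subseteq> K"
  proof
    fix v assume v: "v \<in> (\<Inter>g\<in>R. N g)"
    \<comment> \<open>The representative is taken for \<open>- v\<close> so that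
      \<open>g + v\<close> lies in \<open>H\<close>. Its difference from \<open>g\<close> is
      \<open>v\<close>, which lies in \<open>N g\<close>, and this forces \<open>g\<close> into
      \<open>K\<close>.\<close>
    obtain g where g: "g \<in> R" "- v - g \<in> H" using R(2) by blast
    have h: "g + v \<in> H" using subspace_neg[OF H g(2)] by (simp add: algebra_simps)
    have "(g + v) - g \<in> N g" using v g(1) by simp
    hence "g \<in> K" using N(3)[OF _ h] by blast
    thus "v \<in> K" using subspace_diff[OF K _ \<open>g \<in> K\<close>, of "g + v"] h HK by auto
  qed
  ultimately have openK: "openin \<tau> K"
    using linearly_invariant_open_subspace[OF \<tau> K] N(2) by blast
  \<comment> \<open>Members of \<open>T\<close> vanish on \<open>H\<close>, so finite duality puts
    them in the finite span of \<open>S\<close>; separation from \<open>K\<close> shows that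
    \<open>T\<close> cuts out no more than \<open>K\<close>.\<close>
  define T where "T = {\<psi> \<in> dual. \<forall>y\<in>K. \<psi> y = 0}"
  have "T \<subseteq> fn.span S"
  proof
    fix \<psi> assume "\<psi> \<in> T"
    thus "\<psi> \<in> fn.span S"
      by (intro in_span_if_vanishes_on_annihilator[OF S(1,2)])
         (use HK in \<open>auto simp: T_def H_def\<close>)
  qed
  hence "finite T" using finite_span_finite[OF vector_space_fun_scale S(1)] finite_subset by blast
  moreover have "T \<subseteq> continuous_dual \<tau>"
  proof
    fix \<psi> assume \<psi>: "\<psi> \<in> T"
    hence d: "\<psi> \<in> dual" by (simp add: T_def)
    have "K \<subseteq> {x. \<psi> x = 0}" using \<psi> by (auto simp: T_def)
    hence "openin \<tau> {x. \<psi> x = 0}"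
      by (rule linearly_invariant_open_subspace[OF \<tau> subspace_kernel[OF d] openK subspace_0[OF K]])
    thus "\<psi> \<in> continuous_dual \<tau>" using d by (simp add: continuous_dual_def)
  qed
  moreover have "annihilator T \<subseteq> K"
    using dual_separates[OF K] by (fastforce simp: annihilator_def T_def)
  ultimately show ?thesis using KU by blast
qed

definition separating_subspaces :: "('a \<Rightarrow> 'p mod_ring) set set" where
  "separating_subspaces = {W. fn.subspace W \<and> W \<subseteq> dual \<and> annihilator W = {0}}"

text \<open>Both topologies have the same neighbourhoods of zero: every
  \<open>\<tau>\<close>-neighbourhood contains the annihilator of finitely many continuous
  functionals, and such an annihilator is a finite intersection of open kernels. Together with the
  Hausdorff property this also gives separation of points.\<close>

lemma tbh_continuous_dual:
  assumes \<tau>: "\<tau> \<in> tbh_topologies smul"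
  shows "continuous_dual \<tau> \<in> separating_subspaces" "functional_topology (continuous_dual \<tau>) = \<tau>"
proof -
  have lin: "linearly_invariant smul \<tau>" and tb: "totally_bounded_top \<tau>"
    and haus: "Hausdorff_space \<tau>" and top: "topspace \<tau> = UNIV"
    using \<tau> by (auto simp: tbh_topologies_def linearly_invariant_def)
  have sub: "fn.subspace (continuous_dual \<tau>)" "continuous_dual \<tau> \<subseteq> dual"
    using subspace_continuous_dual[OF lin] by (auto simp: continuous_dual_def)
  have "x = 0" if x: "x \<in> annihilator (continuous_dual \<tau>)" for x
  proof (rule ccontr)
    assume "x \<noteq> 0"
    then obtain U where U: "openin \<tau> U" "0 \<in> U" "x \<notin> U"
      using haus top unfolding Hausdorff_space_def by (metis UNIV_I disjnt_iff)
    then obtain S where "S \<subseteq> continuous_dual \<tau>" "annihilator S \<subseteq> U"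
      using totally_bounded_nhd_contains_annihilator[OF lin tb] by blast
    thus False using x U(3) annihilator_antimono by blast
  qed
  moreover have "0 \<in> annihilator (continuous_dual \<tau>)"
    using sub(2) dual_zero by (auto simp: annihilator_def)
  ultimately show "continuous_dual \<tau> \<in> separating_subspaces"
    using sub by (auto simp: separating_subspaces_def)
  show "functional_topology (continuous_dual \<tau>) = \<tau>"
    unfolding topology_eq
  proof (intro allI iffI)
    fix U assume U: "openin (functional_topology (continuous_dual \<tau>)) U"
    show "openin \<tau> U"
    proof (subst openin_subopen, intro ballI)
      fix x assume "x \<in> U"
      then obtain S where S: "finite S" "S \<subseteq> continuous_dual \<tau>"
        "\<And>y. y - x \<in> annihilator S \<Longrightarrow> y \<in> U"
        using U unfolding openin_functional_topology by blast
      have "openin \<tau> (topspace \<tau> \<inter> (\<Inter>\<phi>\<in>S. {y. \<phi> y = 0}))"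
        using S(1,2) by (intro openin_Int_Inter) (auto simp: continuous_dual_def)
      moreover have "topspace \<tau> \<inter> (\<Inter>\<phi>\<in>S. {y. \<phi> y = 0}) = annihilator S"
        by (auto simp: top annihilator_def)
      ultimately have "openin \<tau> {y. - x + y \<in> annihilator S}"
        using linearly_invariant_openin_translate[OF lin, of "annihilator S" "- x"] by simp
      moreover have "0 \<in> annihilator S"
        using S(2) sub(2) dual_zero by (auto simp: annihilator_def)
      ultimately show "\<exists>T. openin \<tau> T \<and> x \<in> T \<and> T \<subseteq> U"
        using S(3) by (intro exI[of _ "{y. - x + y \<in> annihilator S}"]) auto
    qed
  next
    fix U assume U: "openin \<tau> U"
    show "openin (functional_topology (continuous_dual \<tau>)) U"
      unfolding openin_functional_topology
    proof
      fix x assume x: "x \<in> U"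
      obtain S where S: "finite S" "S \<subseteq> continuous_dual \<tau>" "annihilator S \<subseteq> {y. x + y \<in> U}"
        using totally_bounded_nhd_contains_annihilator[OF lin tb
            linearly_invariant_openin_translate[OF lin U, of x]] x by auto
      have "y \<in> U" if "y - x \<in> annihilator S" for y
        using subsetD[OF S(3) that] by simp
      thus "\<exists>S. finite S \<and> S \<subseteq> continuous_dual \<tau> \<and> (\<forall>y. y - x \<in> annihilator S \<longrightarrow> y \<in> U)"
        using S by blast
    qed
  qed
qed

text \<open>For the forward direction, a kernel that is open for \<open>W'\<close> contains the
  annihilator of a finite \<open>S \<subseteq> W'\<close>. By finite duality the functional then
  lies in the span of \<open>S\<close>, hence in the subspace \<open>W'\<close>.\<close>

lemma functional_topology_le_iff:
  assumes "W \<subseteq> dual" "W' \<subseteq> dual" "fn.subspace W'"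
  shows "functional_topology W \<preceq> functional_topology W' \<longleftrightarrow> W \<subseteq> W'"
proof
  assume sub: "W \<subseteq> W'"
  have "openin (functional_topology W') U" if U: "openin (functional_topology W) U" for U
    unfolding openin_functional_topology
  proof
    fix x assume "x \<in> U"
    then obtain S where "finite S \<and> S \<subseteq> W \<and> (\<forall>y. y - x \<in> annihilator S \<longrightarrow> y \<in> U)"
      using U unfolding openin_functional_topology by meson
    thus "\<exists>S. finite S \<and> S \<subseteq> W' \<and> (\<forall>y. y - x \<in> annihilator S \<longrightarrow> y \<in> U)"
      using sub by (intro exI[of _ S]) auto
  qed
  thus "functional_topology W \<preceq> functional_topology W'"
    by (auto simp: top_le_def)
next
  assume le: "functional_topology W \<preceq> functional_topology W'"
  show "W \<subseteq> W'"
  proof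
    fix \<phi> assume \<phi>: "\<phi> \<in> W"
    have "openin (functional_topology W) {y. y - 0 \<in> annihilator {\<phi>}}"
      by (rule openin_annihilator_coset) (use \<phi> assms in auto)
    hence "openin (functional_topology W') {y. \<phi> y = 0}"
      using le by (auto simp: top_le_def annihilator_def)
    moreover have "0 \<in> {y. \<phi> y = 0}" using \<phi> assms dual_zero by auto
    ultimately obtain S where S: "finite S" "S \<subseteq> W'"
      "\<And>y. y - 0 \<in> annihilator S \<Longrightarrow> y \<in> {y. \<phi> y = 0}"
      unfolding openin_functional_topology by meson
    have "\<phi> \<in> fn.span S"
      by (rule in_span_if_vanishes_on_annihilator) (use S \<phi> assms in auto)
    thus "\<phi> \<in> W'" using fn.span_minimal[OF S(2) assms(3)] by blast
  qed
qed

end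

section \<open>Lattices of topologies\<close>

text \<open>Coordinates with respect to \<open>X\<close> are unique, so those of a vector in both
  spans are supported in \<open>Y\<close> and in \<open>Z\<close>.\<close>

lemma span_Int_independent:
  fixes scale :: "'k::field \<Rightarrow> 'b::ab_group_add \<Rightarrow> 'b"
  assumes "vector_space scale" and X: "\<not> module.dependent scale X" "Y \<subseteq> X" "Z \<subseteq> X"
  shows "module.span scale Y \<inter> module.span scale Z = module.span scale (Y \<inter> Z)"
proof -
  interpret vector_space scale by fact
  have "v \<in> span (Y \<inter> Z)" if v: "v \<in> span Y" "v \<in> span Z" for v
  proof -
    have "representation X v = representation Y v" "representation X v = representation Z v"
      using representation_extend[OF X(1) v(1) X(2)] representation_extend[OF X(1) v(2) X(3)] by auto
    hence supp: "b \<in> Y \<inter> Z" if "representation X v b \<noteq> 0" for b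
      using that representation_ne_zero[of Y v b] representation_ne_zero[of Z v b] by auto
    have "v \<in> span X" using v(1) X(2) span_mono by blast
    hence "v = (\<Sum>b | representation X v b \<noteq> 0. scale (representation X v b) b)"
      using sum_nonzero_representation_eq[OF X(1)] by simp
    also have "\<dots> \<in> span (Y \<inter> Z)"
      using supp by (intro span_sum span_scale span_base supp) simp
    finally show ?thesis .
  qed
  thus ?thesis using span_mono[of "Y \<inter> Z" Y] span_mono[of "Y \<inter> Z" Z] by blast
qed

section \<open>Cardinal arithmetic and long chains of subsets\<close>

lemma cpow_eq_cexp: "|Pow B| =o ctwo ^c |B|"
  unfolding cexp_def ctwo_def Field_card_of by (rule card_of_Pow_Func)

lemma not_card_of_ordLeq_iff: "\<not> |A| \<le>o |X| \<longleftrightarrow> |X| <o |A|"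
  by (rule not_ordLeq_iff_ordLess) (rule card_of_Well_order)+

lemma card_of_Pow_mono: "|A| \<le>o |X| \<Longrightarrow> |Pow A| \<le>o |Pow X|"
  unfolding card_of_ordLeq[symmetric] by (meson image_Pow_mono inj_on_image_Pow)

lemma ordLess_diff_if_ordLeq_infinite:
  assumes "infinite A" "|A| \<le>o |X|" "|Y| <o |A|"
  shows "|A| \<le>o |X - Y|"
proof (rule ccontr)
  assume "\<not> ?thesis"
  hence "|X - Y| <o |A|" by (simp add: not_card_of_ordLeq_iff)
  hence "|(X - Y) \<union> Y| <o |A|" by (rule card_of_Un_ordLess_infinite[OF assms(1) _ assms(3)])
  moreover have "|X| \<le>o |(X - Y) \<union> Y|" by (rule card_of_mono1) blast
  ultimately show False using assms(2)
    by (meson not_ordLess_ordLeq ordLeq_ordLess_trans)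
qed

text \<open>The strict initial segments of a well-order on \<open>M\<close> are comparable, and
  distinct elements give distinct segments. The sets \<open>{}\<close> and \<open>M\<close> are put
  in so that the chain reaches both ends of the powerset.\<close>

lemma maximal_length_chain:
  fixes M :: "'b set"
  assumes "infinite M"
  shows "\<exists>D \<subseteq> Pow M. {} \<in> D \<and> M \<in> D \<and> |D| =o |M| \<and> (\<forall>S\<in>D. \<forall>T\<in>D. S \<subseteq> T \<or> T \<subseteq> S)"
proof -
  define r where "r = |M|"
  have r: "Well_order r" "Field r = M" by (simp_all add: r_def card_of_well_order_on Field_card_of)
  hence lin: "trans r" "antisym r" "\<And>a b. a \<in> M \<Longrightarrow> b \<in> M \<Longrightarrow> a \<noteq> b \<Longrightarrow> (a, b) \<in> r \<or> (b, a) \<in> r"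
    unfolding well_order_on_def linear_order_on_def partial_order_on_def preorder_on_def total_on_def
    by auto
  define D where "D = {{}, M} \<union> underS r ` M"
  have underS: "underS r a \<subseteq> M" for a using r(2) by (auto simp: underS_def Field_def)
  have chain: "underS r a \<subseteq> underS r b \<or> underS r b \<subseteq> underS r a" if "a \<in> M" "b \<in> M" for a b
    using lin(3)[OF that] transD[OF lin(1)] antisymD[OF lin(2)] unfolding underS_def by blast
  have inj: "inj_on (underS r) M"
  proof (rule inj_onI, rule ccontr)
    fix a b assume ab: "a \<in> M" "b \<in> M" "underS r a = underS r b" "a \<noteq> b"
    hence "a \<in> underS r b \<or> b \<in> underS r a" using lin(3) by (auto simp: underS_def)
    thus False using ab(3) by (auto simp: underS_def)
  qed
  have "|M| \<le>o |D|"
    using inj by (intro card_of_ordLeqI[of "underS r"]) (auto simp: D_def)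
  moreover have "|D| \<le>o |M|"
    unfolding D_def
  proof (rule card_of_Un_ordLeq_infinite_Field)
    show "infinite (Field |M| )" "Card_order |M|"
      using assms by (simp_all add: Field_card_of card_of_card_order_on)
    show "|{{}, M}| \<le>o |M|" using assms by (intro ordLess_imp_ordLeq ordLeq3_finite_infinite) auto
    show "|underS r ` M| \<le>o |M|" by (rule card_of_image)
  qed
  ultimately have "|D| =o |M|" by (simp add: ordIso_iff_ordLeq)
  moreover have "D \<subseteq> Pow M" using underS by (auto simp: D_def)
  moreover have "\<forall>S\<in>D. \<forall>T\<in>D. S \<subseteq> T \<or> T \<subseteq> S"
    using underS chain by (auto simp: D_def)
  ultimately show ?thesis unfolding D_def by blast
qed

section \<open>Powerset lattices of topologies from independent functionals\<close>

context fp_space begin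

lemma functional_topology_tbh':
  "W \<in> separating_subspaces \<Longrightarrow> functional_topology W \<in> tbh_topologies smul"
  using functional_topology_tbh by (auto simp: separating_subspaces_def)

lemma functional_topology_le_iff':
  "W \<in> separating_subspaces \<Longrightarrow> W' \<in> separating_subspaces \<Longrightarrow>
    functional_topology W \<preceq> functional_topology W' \<longleftrightarrow> W \<subseteq> W'"
  by (rule functional_topology_le_iff) (auto simp: separating_subspaces_def)

lemma tbh_topologies_eq: "tbh_topologies smul = functional_topology ` separating_subspaces"
  using functional_topology_tbh' tbh_continuous_dual by (metis image_eqI image_subsetI subsetI subset_antisym)

text \<open>The last hypothesis expresses by a universal property that \<open>W\<close> is the sum
  of the subspaces \<open>W1\<close> and \<open>W2\<close>.\<close>

lemma is_sup_functional_topology: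
  assumes "W1 \<in> separating_subspaces" "W2 \<in> separating_subspaces" "W \<in> separating_subspaces"
    and "\<And>W'. fn.subspace W' \<Longrightarrow> W \<subseteq> W' \<longleftrightarrow> W1 \<subseteq> W' \<and> W2 \<subseteq> W'"
  shows "is_sup_in (tbh_topologies smul) (functional_topology W1) (functional_topology W2)
    (functional_topology W)"
proof -
  have "fn.subspace W'" if "W' \<in> separating_subspaces" for W'
    using that by (simp add: separating_subspaces_def)
  thus ?thesis unfolding is_sup_in_def tbh_topologies_eq
    using assms by (auto simp: functional_topology_le_iff')
qed

text \<open>The intersection of two separating subspaces need not separate points, so this is
  assumed of \<open>W1 \<inter> W2\<close>.\<close>

lemma is_inf_functional_topology:
  assumes "W1 \<in> separating_subspaces" "W2 \<in> separating_subspaces" "W1 \<inter> W2 \<in> separating_subspaces"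
  shows "is_inf_in (tbh_topologies smul) (functional_topology W1) (functional_topology W2)
    (functional_topology (W1 \<inter> W2))"
  unfolding is_inf_in_def tbh_topologies_eq
  using assms by (auto simp: functional_topology_le_iff')

text \<open>All spans involved contain \<open>fn.span C\<close> and therefore separate points.
  Independence of \<open>C \<union> D\<close> lets \<open>S\<close> be recovered from its span and
  turns intersections of spans into spans of intersections; unions correspond to sums in any
  case.\<close>

lemma independent_powerset_lattice_iso:
  assumes ind: "fn.independent (C \<union> D)" and disj: "C \<inter> D = {}" and sub: "C \<union> D \<subseteq> dual"
    and sep: "annihilator (fn.span C) = {0}" and g: "bij_betw g M D"
  defines "F \<equiv> \<lambda>S. functional_topology (fn.span (C \<union> g ` S))"
  shows "powerset_lattice_iso M (tbh_topologies smul) (F ` Pow M) F"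
proof -
  define E where "E S = fn.span (C \<union> g ` S)" for S
  have F: "F S = functional_topology (E S)" for S by (simp add: F_def E_def)
  have gD: "g ` S \<subseteq> D" if "S \<subseteq> M" for S
    using that g by (auto simp: bij_betw_def)
  have E_sep: "E S \<in> separating_subspaces" if "S \<subseteq> M" for S
  proof -
    have "E S \<subseteq> dual" unfolding E_def using gD[OF that] sub by (intro span_dual) auto
    moreover from this have "0 \<in> annihilator (E S)"
      using dual_zero by (auto simp: annihilator_def)
    moreover have "annihilator (E S) \<subseteq> annihilator (fn.span C)"
      unfolding E_def by (intro annihilator_antimono fn.span_mono) auto
    ultimately show ?thesis using sep by (auto simp: separating_subspaces_def E_def)
  qed
  have E_mono: "E S \<subseteq> E T \<longleftrightarrow> S \<subseteq> T" if "S \<subseteq> M" "T \<subseteq> M" for S T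
  proof
    assume "S \<subseteq> T"
    thus "E S \<subseteq> E T" unfolding E_def by (intro fn.span_mono) auto
  next
    assume le: "E S \<subseteq> E T"
    show "S \<subseteq> T"
    proof (rule ccontr)
      assume "\<not> S \<subseteq> T"
      then obtain s where s: "s \<in> S" "s \<notin> T" by blast
      have gs: "g s \<in> D" using gD[OF that(1)] s by blast
      have "g s \<notin> g ` T"
        using s that g by (metis bij_betw_def image_eqI inj_on_image_mem_iff subsetD)
      hence "C \<union> g ` T \<subseteq> (C \<union> D) - {g s}" using disj gs gD[OF that(2)] by blast
      moreover have "g s \<in> E T" using le s unfolding E_def by (blast intro: fn.span_base)
      ultimately have "g s \<in> fn.span ((C \<union> D) - {g s})"
        unfolding E_def using fn.span_mono by blast
      thus False using ind gs unfolding fn.dependent_def by blast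
    qed
  qed
  have le: "F S \<preceq> F T \<longleftrightarrow> S \<subseteq> T" if "S \<subseteq> M" "T \<subseteq> M" for S T
    unfolding F using functional_topology_le_iff'[OF E_sep E_sep] E_mono that by simp
  have "inj_on F (Pow M)"
  proof (rule inj_onI)
    fix S T assume ST: "S \<in> Pow M" "T \<in> Pow M" "F S = F T"
    hence "F S \<preceq> F T" "F T \<preceq> F S" by (auto simp: top_le_def)
    thus "S = T" using le ST(1,2) by auto
  qed
  moreover have "F ` Pow M \<subseteq> tbh_topologies smul"
    using E_sep functional_topology_tbh' by (auto simp: F)
  moreover have "is_sup_in (tbh_topologies smul) (F S) (F T) (F (S \<union> T))" if "S \<subseteq> M" "T \<subseteq> M" for S T
    unfolding F
  proof (rule is_sup_functional_topology)
    fix W' :: "('a \<Rightarrow> 'p mod_ring) set" assume W': "fn.subspace W'"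
    have "E U \<subseteq> W' \<longleftrightarrow> C \<union> g ` U \<subseteq> W'" for U
      unfolding E_def
      using fn.span_superset[of "C \<union> g ` U"] fn.span_minimal[of "C \<union> g ` U" W'] W' by blast
    thus "E (S \<union> T) \<subseteq> W' \<longleftrightarrow> E S \<subseteq> W' \<and> E T \<subseteq> W'" by (auto simp: image_Un)
  qed (use that E_sep in auto)
  moreover have "is_inf_in (tbh_topologies smul) (F S) (F T) (F (S \<inter> T))" if "S \<subseteq> M" "T \<subseteq> M" for S T
  proof -
    have "E S \<inter> E T = fn.span ((C \<union> g ` S) \<inter> (C \<union> g ` T))"
      unfolding E_def using gD that
      by (intro span_Int_independent[OF vector_space_fun_scale ind]) auto
    also have "(C \<union> g ` S) \<inter> (C \<union> g ` T) = C \<union> g ` (S \<inter> T)"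
      using that g inj_on_image_Int[of g M S T] by (auto simp: bij_betw_def)
    finally have eq: "E S \<inter> E T = E (S \<inter> T)" by (simp add: E_def)
    have "E (S \<inter> T) \<in> separating_subspaces" using that by (intro E_sep) auto
    thus ?thesis
      using is_inf_functional_topology[OF E_sep[OF that(1)] E_sep[OF that(2)]] by (simp add: F eq)
  qed
  ultimately show ?thesis
    unfolding powerset_lattice_iso_def bij_betw_def using le by auto
qed

text \<open>From below, indicator functions of subsets of \<open>B\<close> extend to functionals.
  From above, a functional is determined by its graph over \<open>B\<close>, a subset of a product
  of cardinality \<open>|B|\<close>.\<close>

lemma card_of_dual:
  assumes B: "independent B" "span B = UNIV" "infinite B"
  shows "|dual| =o |Pow B|"
proof -
  define f where "f S = functional.construct B (\<lambda>v. if v \<in> S then 1 else 0 :: 'p mod_ring)" for S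
  have f: "f S v = (if v \<in> S then 1 else 0)" if "v \<in> B" for S v
    using that by (simp add: f_def functional.construct_basis B)
  have "inj_on f (Pow B)"
  proof (rule inj_onI)
    fix S T assume ST: "S \<in> Pow B" "T \<in> Pow B" "f S = f T"
    have "v \<in> S \<longleftrightarrow> v \<in> T" if "v \<in> B" for v
      using f[OF that, of S] f[OF that, of T] ST(3) by (auto split: if_splits)
    thus "S = T" using ST(1,2) by blast
  qed
  moreover have "f ` Pow B \<subseteq> dual" by (auto simp: f_def dual_def functional.linear_construct B)
  ultimately have ge: "|Pow B| \<le>o |dual|" by (meson card_of_ordLeqI image_subset_iff)
  define h where "h \<phi> = (\<lambda>b. (b, \<phi> b)) ` B" for \<phi> :: "'a \<Rightarrow> 'p mod_ring"
  have "inj_on h dual"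
  proof (rule inj_onI)
    fix \<phi> \<psi> assume *: "\<phi> \<in> dual" "\<psi> \<in> dual" "h \<phi> = h \<psi>"
    hence "\<phi> b = \<psi> b" if "b \<in> B" for b using that by (auto simp: h_def)
    hence "\<phi> x = \<psi> x" for x using dual_eqI[OF *(1,2), of B x] B(2) by simp
    thus "\<phi> = \<psi>" by blast
  qed
  moreover have "h ` dual \<subseteq> Pow (B \<times> UNIV)" by (auto simp: h_def)
  ultimately have "|dual| \<le>o |Pow (B \<times> (UNIV :: 'p mod_ring set))|"
    by (meson card_of_ordLeqI image_subset_iff)
  moreover have "|B \<times> (UNIV :: 'p mod_ring set)| \<le>o |B|"
  proof (rule card_of_Sigma_ordLeq_infinite[OF B(3)])
    show "|B| \<le>o |B|" by (rule ordLeq_refl[OF card_of_Card_order])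
    show "\<forall>b\<in>B. |UNIV :: 'p mod_ring set| \<le>o |B|"
      using B(3) by (intro ballI ordLess_imp_ordLeq ordLeq3_finite_infinite) auto
  qed
  ultimately have "|dual| \<le>o |Pow B|"
    by (meson card_of_Pow_mono ordLeq_transitive)
  thus ?thesis using ge by (simp add: ordIso_iff_ordLeq)
qed

text \<open>This turns cardinalities of spaces into numbers of generators: over a finite field an
  infinite span is no larger than its generating set, and removing fewer than \<open>|K|\<close>
  generators leaves at least \<open>|K|\<close> of them.\<close>

lemma independent_complement_large:
  assumes Y: "infinite K" "X0 \<subseteq> X" "|X0| <o |K|" "|K| \<le>o |fn.span X|"
  shows "|K| \<le>o |X - X0|"
proof -
  have "infinite (fn.span X)" using Y(1,4) card_of_ordLeq_infinite by blast
  hence "infinite X" using finite_span_finite[OF vector_space_fun_scale] by blast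
  hence "|fn.span X| \<le>o |X|" by (rule card_of_span_le[OF vector_space_fun_scale])
  hence "|K| \<le>o |X|" using Y(4) ordLeq_transitive by blast
  thus ?thesis using ordLess_diff_if_ordLeq_infinite Y(1,3) by blast
qed

text \<open>Either \<open>W\<close> or its linear complements in the dual have dimension \<open>2\<^bsup>|B|\<^esup>\<close>.  In the first case
  \<open>W\<close> contains a separating subspace of dimension at most \<open>|B|\<close>, since the space has only \<open>|B|\<close> many
  elements, and the lattice lies below \<open>W\<close>; in the second it lies above \<open>W\<close>.\<close>

lemma separating_subspace_in_cube:
  assumes B: "independent B" "span B = UNIV" "infinite B" and W: "W \<in> separating_subspaces"
  shows "\<exists>C D. fn.independent (C \<union> D) \<and> C \<inter> D = {} \<and> C \<union> D \<subseteq> dual \<and>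
    annihilator (fn.span C) = {0} \<and> |D| =o |Pow B| \<and> (W = fn.span C \<or> W = fn.span (C \<union> D))"
proof -
  have inf: "infinite (Pow B)" using B by simp
  have W': "fn.subspace W" "W \<subseteq> dual" "annihilator W = {0}"
    using W by (auto simp: separating_subspaces_def)
  have dual_card: "|dual| =o |Pow B|" by (rule card_of_dual[OF B])
  have le: "|D| \<le>o |Pow B|" if "D \<subseteq> dual" for D
    using card_of_mono1[OF that] dual_card ordLeq_ordIso_trans by blast
  show ?thesis
  proof (cases "|Pow B| \<le>o |W|")
    case True
    have "\<exists>\<phi>. \<phi> \<in> W \<and> \<phi> x \<noteq> 0" if "x \<noteq> 0" for x
    proof (rule ccontr)
      assume "\<not> ?thesis"
      hence "x \<in> annihilator W" by (auto simp: annihilator_def)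
      thus False using W' that by simp
    qed
    \<comment> \<open>One functional of \<open>W\<close> for each nonzero vector already separates
      points; \<open>C\<close> is a maximal independent subset of these, so it has at most as many
      elements as the space.\<close>
    then obtain f where f: "\<And>x. x \<noteq> 0 \<Longrightarrow> f x \<in> W \<and> f x x \<noteq> 0" by metis
    obtain C where C: "C \<subseteq> f ` (- {0})" "fn.independent C" "f ` (- {0}) \<subseteq> fn.span C"
      using fn.maximal_independent_subset by blast
    have CW: "C \<subseteq> W" using C f by auto
    \<comment> \<open>\<open>X\<close> completes \<open>C\<close> to a basis of \<open>W\<close>.
      The new elements form \<open>D\<close>, so that \<open>W\<close> is the top of its
      lattice.\<close>
    obtain X where X: "C \<subseteq> X" "X \<subseteq> W" "fn.independent X" "W \<subseteq> fn.span X"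
      using fn.maximal_independent_subset_extend[OF CW C(2)] by blast
    have spanX: "fn.span X = W" using X W'(1) fn.span_minimal by blast
    have "|C| \<le>o |f ` (- {0})|" using C(1) by (rule card_of_mono1)
    moreover have "|f ` (- {0})| \<le>o |- {0} :: 'a set|" by (rule card_of_image)
    moreover have "|- {0} :: 'a set| \<le>o |UNIV :: 'a set|" by (rule card_of_mono1) simp
    moreover have "|UNIV :: 'a set| \<le>o |B|"
      using card_of_span_le[OF vector_space_axioms B(3)] by (simp add: B(2))
    ultimately have "|C| <o |Pow B|"
      using card_of_Pow ordLeq_transitive ordLeq_ordLess_trans by metis
    hence "|Pow B| \<le>o |X - C|"
      using independent_complement_large[OF inf X(1)] True by (simp add: spanX)
    moreover have "|X - C| \<le>o |Pow B|" using X W' by (intro le) blast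
    ultimately have card: "|X - C| =o |Pow B|" by (simp add: ordIso_iff_ordLeq)
    have "x = 0" if "x \<in> annihilator (fn.span C)" for x
      using f[of x] C(3) that by (auto simp: annihilator_def)
    moreover have "0 \<in> annihilator (fn.span C)"
      using span_dual[of C] CW W'(2) dual_zero by (auto simp: annihilator_def)
    ultimately have "annihilator (fn.span C) = {0}" by blast
    thus ?thesis using X W' card spanX
      by (intro exI[of _ C] exI[of _ "X - C"]) (auto simp: Un_absorb1)
  next
    case False
    hence small: "|W| <o |Pow B|" by (simp add: not_card_of_ordLeq_iff)
    obtain C where C: "C \<subseteq> W" "fn.independent C" "W \<subseteq> fn.span C"
      using fn.maximal_independent_subset by blast
    have spanC: "fn.span C = W" using C W'(1) fn.span_minimal by blast
    \<comment> \<open>Here \<open>C\<close> is a basis of \<open>W\<close> itself and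
      \<open>D\<close> completes it to a basis of the dual, so that \<open>W\<close> is the bottom
      of its lattice.\<close>
    obtain X where X: "C \<subseteq> X" "X \<subseteq> dual" "fn.independent X" "dual \<subseteq> fn.span X"
      using fn.maximal_independent_subset_extend[of C dual] C W'(2) by blast
    have spanX: "fn.span X = dual" using X subspace_dual fn.span_minimal by blast
    have "|C| <o |Pow B|" using card_of_mono1[OF C(1)] small ordLeq_ordLess_trans by blast
    hence "|Pow B| \<le>o |X - C|"
      using independent_complement_large[OF inf X(1)] dual_card by (simp add: spanX ordIso_iff_ordLeq)
    moreover have "|X - C| \<le>o |Pow B|" using X by (intro le) blast
    ultimately have card: "|X - C| =o |Pow B|" by (simp add: ordIso_iff_ordLeq)
    show ?thesis using X W' card spanC
      by (intro exI[of _ C] exI[of _ "X - C"]) (auto simp: Un_absorb1)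
  qed
qed

text \<open>The two alternatives for the subspace of \<open>\<tau>\<close> make
  \<open>\<tau>\<close> the image of \<open>{}\<close>, hence least, or of the whole index set
  \<open>Pow B\<close>, hence greatest.\<close>

lemma tbh_in_cube:
  assumes B: "independent B" "span B = UNIV" "infinite B" and \<tau>: "\<tau> \<in> tbh_topologies smul"
  shows "\<exists>L F. powerset_lattice_iso (Pow B) (tbh_topologies smul) L F \<and>
    \<tau> \<in> L \<and> ((\<forall>\<sigma>\<in>L. \<tau> \<preceq> \<sigma>) \<or> (\<forall>\<sigma>\<in>L. \<sigma> \<preceq> \<tau>))"
proof -
  define W where "W = continuous_dual \<tau>"
  have W: "W \<in> separating_subspaces" "functional_topology W = \<tau>"
    using tbh_continuous_dual[OF \<tau>] by (simp_all add: W_def)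
  obtain C D where CD: "fn.independent (C \<union> D)" "C \<inter> D = {}" "C \<union> D \<subseteq> dual"
    "annihilator (fn.span C) = {0}" "|D| =o |Pow B|" "W = fn.span C \<or> W = fn.span (C \<union> D)"
    using separating_subspace_in_cube[OF B W(1)] by blast
  obtain g where g: "bij_betw g (Pow B) D"
    using CD(5) by (meson card_of_ordIso ordIso_symmetric)
  define F where "F = (\<lambda>S. functional_topology (fn.span (C \<union> g ` S)))"
  have iso: "powerset_lattice_iso (Pow B) (tbh_topologies smul) (F ` Pow (Pow B)) F"
    unfolding F_def by (rule independent_powerset_lattice_iso[OF CD(1-4) g])
  hence mono: "F S \<preceq> F T" if "S \<subseteq> T" "T \<subseteq> Pow B" for S T
    using that unfolding powerset_lattice_iso_def by (metis PowI order_trans)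
  have "g ` Pow B = D" using g by (simp add: bij_betw_def)
  hence "\<tau> = F {} \<or> \<tau> = F (Pow B)"
    using CD(6) W(2) by (auto simp: F_def)
  hence "\<tau> \<in> F ` Pow (Pow B) \<and>
      ((\<forall>\<sigma>\<in>F ` Pow (Pow B). \<tau> \<preceq> \<sigma>) \<or> (\<forall>\<sigma>\<in>F ` Pow (Pow B). \<sigma> \<preceq> \<tau>))"
    using mono by blast
  thus ?thesis using iso by blast
qed

end

text \<open>An extremal \<open>\<sigma>\<close> can only be \<open>F {}\<close> or
  \<open>F M\<close>, and both lie in the image of a chain of subsets that contains
  \<open>{}\<close> and \<open>M\<close>.\<close>

lemma powerset_lattice_iso_chain:
  assumes iso: "powerset_lattice_iso M P L F" and M: "infinite M"
    and \<sigma>: "\<sigma> \<in> L" "(\<forall>\<rho>\<in>L. \<sigma> \<preceq> \<rho>) \<or> (\<forall>\<rho>\<in>L. \<rho> \<preceq> \<sigma>)"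
  shows "\<exists>C \<subseteq> P. \<sigma> \<in> C \<and> |C| =o |M| \<and> (\<forall>\<rho>\<in>C. \<forall>\<upsilon>\<in>C. \<rho> \<preceq> \<upsilon> \<or> \<upsilon> \<preceq> \<rho>)"
proof -
  have LP: "L \<subseteq> P" and bij: "bij_betw F (Pow M) L"
    and le: "\<And>S T. S \<subseteq> M \<Longrightarrow> T \<subseteq> M \<Longrightarrow> F S \<preceq> F T \<longleftrightarrow> S \<subseteq> T"
    using iso unfolding powerset_lattice_iso_def by auto
  have L: "L = F ` Pow M" and inj: "inj_on F (Pow M)" using bij by (auto simp: bij_betw_def)
  obtain D where D: "D \<subseteq> Pow M" "{} \<in> D" "M \<in> D" "|D| =o |M|"
    "\<forall>S\<in>D. \<forall>T\<in>D. S \<subseteq> T \<or> T \<subseteq> S"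
    using maximal_length_chain[OF M] by (elim exE conjE)
  obtain S where S: "S \<subseteq> M" "\<sigma> = F S" using \<sigma>(1) L by blast
  have "S = {} \<or> S = M"
  proof -
    have "\<sigma> \<preceq> F {} \<or> F M \<preceq> \<sigma>" using \<sigma>(2) L by blast
    thus ?thesis using le S by auto
  qed
  hence "\<sigma> \<in> F ` D" using S D by blast
  moreover have "|F ` D| =o |M|"
  proof -
    have "inj_on F D" using inj D(1) by (rule inj_on_subset)
    hence "|D| =o |F ` D|" by (meson card_of_ordIso bij_betw_imageI)
    thus ?thesis using D(4) ordIso_symmetric ordIso_transitive by blast
  qed
  moreover have "\<forall>\<rho>\<in>F ` D. \<forall>\<upsilon>\<in>F ` D. \<rho> \<preceq> \<upsilon> \<or> \<upsilon> \<preceq> \<rho>"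
  proof (intro ballI, elim imageE)
    fix \<rho> \<upsilon> S T assume "\<rho> = F S" "S \<in> D" "\<upsilon> = F T" "T \<in> D"
    moreover from this have "S \<subseteq> M" "T \<subseteq> M" "S \<subseteq> T \<or> T \<subseteq> S" using D(1,5) by auto
    ultimately show "\<rho> \<preceq> \<upsilon> \<or> \<upsilon> \<preceq> \<rho>"
      using le by auto
  qed
  moreover have "F ` D \<subseteq> P" using D(1) L LP by blast
  ultimately show ?thesis by blast
qed

theorem proposition1p6:
  fixes smul :: "'p::prime_card mod_ring \<Rightarrow> 'a::ab_group_add \<Rightarrow> 'a"
    and B :: "'a set"
    and \<tau> :: "'a topology"
  assumes "vector_space smul"
    and "\<not> module.dependent smul B" and "module.span smul B = UNIV"
    and "infinite B"
    and "\<tau> \<in> tbh_topologies smul"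
  shows
    "(\<exists>M :: 'a set set. |M| =o ctwo ^c |B| \<and>
        (\<exists>L F. powerset_lattice_iso M (tbh_topologies smul) L F \<and>
           \<tau> \<in> L \<and> ((\<forall>\<sigma>\<in>L. \<tau> \<preceq> \<sigma>) \<or> (\<forall>\<sigma>\<in>L. \<sigma> \<preceq> \<tau>)))) \<and>
     (\<forall>\<sigma>\<in>tbh_topologies smul. \<exists>C \<subseteq> tbh_topologies smul.
        \<sigma> \<in> C \<and> |C| =o ctwo ^c |B| \<and>
        (\<forall>\<rho>\<in>C. \<forall>\<upsilon>\<in>C. \<rho> \<preceq> \<upsilon> \<or> \<upsilon> \<preceq> \<rho>))"
proof -
  interpret fp_space smul using assms(1) by (simp add: fp_space_def)
  note cube = tbh_in_cube[OF assms(2-4)]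
  have "infinite (Pow B)" using assms(4) by simp
  \<comment> \<open>The chain is required for an arbitrary \<open>\<sigma>\<close>, so it is taken
    in a lattice built for \<open>\<sigma>\<close> and not in the one for
    \<open>\<tau>\<close>.\<close>
  have "\<exists>C \<subseteq> tbh_topologies smul. \<sigma> \<in> C \<and> |C| =o ctwo ^c |B| \<and>
      (\<forall>\<rho>\<in>C. \<forall>\<upsilon>\<in>C. \<rho> \<preceq> \<upsilon> \<or> \<upsilon> \<preceq> \<rho>)" if \<sigma>: "\<sigma> \<in> tbh_topologies smul" for \<sigma>
  proof -
    obtain L F where LF: "powerset_lattice_iso (Pow B) (tbh_topologies smul) L F"
      "\<sigma> \<in> L" "(\<forall>\<rho>\<in>L. \<sigma> \<preceq> \<rho>) \<or> (\<forall>\<rho>\<in>L. \<rho> \<preceq> \<sigma>)"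
      using cube[OF \<sigma>] by blast
    obtain C where C: "C \<subseteq> tbh_topologies smul" "\<sigma> \<in> C" "|C| =o |Pow B|"
      "\<forall>\<rho>\<in>C. \<forall>\<upsilon>\<in>C. \<rho> \<preceq> \<upsilon> \<or> \<upsilon> \<preceq> \<rho>"
      using powerset_lattice_iso_chain[OF LF(1) \<open>infinite (Pow B)\<close> LF(2,3)] by blast
    thus ?thesis using ordIso_transitive[OF C(3) cpow_eq_cexp] by blast
  qed
  moreover have "\<exists>M :: 'a set set. |M| =o ctwo ^c |B| \<and>
      (\<exists>L F. powerset_lattice_iso M (tbh_topologies smul) L F \<and>
        \<tau> \<in> L \<and> ((\<forall>\<sigma>\<in>L. \<tau> \<preceq> \<sigma>) \<or> (\<forall>\<sigma>\<in>L. \<sigma> \<preceq> \<tau>)))"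
    by (intro exI[of _ "Pow B"] conjI cpow_eq_cexp cube[OF assms(5)])
  ultimately show ?thesis by blast
qed

end
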